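(* Let $T\subset\mathbb{N}$ be a divisor stable subset. Assume that for $A_\bullet=(A_S)_{S\preccurlyeq T}$ in $\mathcal{RF}_T$ the ring $A=A_{\{1\}}$ has no $T$-torsion. Then there is a unique morphism $\alpha=(\alpha_S)_{S\preccurlyeq T}:A_\bullet\to W_\bullet(A)$ in $\mathcal{RF}_T$ with $\alpha_S=\mathrm{id}_A$ for $S=\{1\}$. The morphism $\alpha$ is functorial in $A_\bullet$. Explicitly it is given as follows: the composition of $\alpha_S:A_S\to W_S(A)$ with the (injective) ghost map $\log_S:W_S(A)\to A^S$ is given by the formula $$(\log_S\circ\alpha_S)(a)=(\pi F_n(a))_{n\in S}\quad\text{for } a\in A_S,$$ where $\pi$ denotes the transition map $\pi:A_{S/n}\to A_{\{1\}}=A$.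
   Context: Conventions. Rings are commutative and associative, not necessarily unital; the category $\mathcal{RF}_T$ exists in a unital version (all rings and homomorphisms unital) and a non-unital version, and the result holds in both. $\mathbb{N}=\{1,2,\dots\}$. A non-empty $S\subset\mathbb{N}$ is divisor stable if $n\in S$, $d\mid n$ imply $d\in S$. For $n\in S$ put $S/n=\{\nu\in S\mid \nu n\in S\}$. $S\preccurlyeq T$ means $S$ is a divisor stable subset of $T$. $A$ has no $T$-torsion if multiplication by each $n\in T$ is injective on $A$. The category $\mathcal{RF}_T$. An object is a projective system of rings $A_\bullet=(A_S)_{S\preccurlyeq T}$ (a contravariant functor on the ordered set of $S\preccurlyeq T$; transition maps $\pi:A_{S_2}\to A_{S_1}$ for $S_1\preccurlyeq S_2\preccurlyeq T$) together with, for all primes $p\in S\preccurlyeq T$, ring homomorphisms $F_p:A_S\to A_{S/p}$ such that: (1) $F_p(a)\equiv\pi(a)^p \bmod pA_{S/p}$ for $a\in A_S$; (2) for $p\in S_1\preccurlyeq S_2\preccurlyeq T$ one has $\pi F_p=F_p\pi:A_{S_2}\to A_{S_1/p}$; (3) $F_lF_p=F_pF_l:A_S\to A_{S/pl}$ for primes $p,l$ with $pl\in S$. For $n=p_1^{\nu_1}\cdots p_r^{\nu_r}\in S$ one sets $F_n=F_{p_1}^{\nu_1}\circ\cdots\circ F_{p_r}^{\nu_r}:A_S\to A_{S/n}$. Morphisms are families of ring homomorphisms compatible with $\pi$ and the $F_p$. Witt vectors. For a ring $A$, $W_S(A)=A^S$ as a set, with the unique ring structure functorial in $A$ for which the ghost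 map $\log_S:W_S(A)\to A^S$, $(a_d)_{d\in S}\mapsto(\sum_{d\mid n}d\,a_d^{n/d})_{n\in S}$ is a ring homomorphism ($A^S$ the product ring). There are the projections $\pi:W_{S}(A)\to W_{S'}(A)$ for $S'\preccurlyeq S$ and functorial Frobenius ring homomorphisms $F_n:W_S(A)\to W_{S/n}(A)$, given on ghost components by $(a_\nu)_{\nu\in S}\mapsto(a_{n\nu})_{\nu\in S/n}$. With these, $W_\bullet(A):=(W_S(A))_{S\preccurlyeq T}$ is an object of $\mathcal{RF}_T$. *)

theory Defs
  imports
    "HOL-Algebra.Ring"
    "HOL-Library.Poly_Mapping"
    "HOL-Computational_Algebra.Primes"
begin

section \<open>Divisor stable sets\<close>

definition divisor_stable :: "nat set \<Rightarrow> bool" where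
  "divisor_stable S \<longleftrightarrow> S \<noteq> {} \<and> 0 \<notin> S \<and> (\<forall>n\<in>S. \<forall>d. d dvd n \<longrightarrow> d \<in> S)"

definition ds_subset :: "nat set \<Rightarrow> nat set \<Rightarrow> bool"  (infix \<open>\<preceq>\<close> 50) where
  "S \<preceq> T \<longleftrightarrow> divisor_stable S \<and> S \<subseteq> T"

definition ds_quot :: "nat set \<Rightarrow> nat \<Rightarrow> nat set"  (infixl \<open>\<oslash>\<close> 70) where
  "S \<oslash> n = {\<nu> \<in> S. \<nu> * n \<in> S}"


section \<open>Commutative rings, with or without unit\<close>

text \<open>Rings are records of HOL-Algebra. In a non-unital ring the field \<open>one\<close> of the
  record carries no meaning and must not be referred to; this excludes the library's power
  operation.\<close>

locale comm_rng = abelian_group R for R (structure) +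
  assumes m_closed: "\<lbrakk>x \<in> carrier R; y \<in> carrier R\<rbrakk> \<Longrightarrow> x \<otimes> y \<in> carrier R"
    and m_assoc: "\<lbrakk>x \<in> carrier R; y \<in> carrier R; z \<in> carrier R\<rbrakk>
          \<Longrightarrow> (x \<otimes> y) \<otimes> z = x \<otimes> (y \<otimes> z)"
    and m_comm: "\<lbrakk>x \<in> carrier R; y \<in> carrier R\<rbrakk> \<Longrightarrow> x \<otimes> y = y \<otimes> x"
    and l_distr: "\<lbrakk>x \<in> carrier R; y \<in> carrier R; z \<in> carrier R\<rbrakk>
          \<Longrightarrow> (x \<oplus> y) \<otimes> z = x \<otimes> z \<oplus> y \<otimes> z"

definition rng_hom :: "('a, 'm) ring_scheme \<Rightarrow> ('b, 'n) ring_scheme \<Rightarrow> ('a \<Rightarrow> 'b) set" where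
  "rng_hom R S = {h \<in> carrier R \<rightarrow> carrier S. \<forall>x\<in>carrier R. \<forall>y\<in>carrier R.
      h (x \<otimes>\<^bsub>R\<^esub> y) = h x \<otimes>\<^bsub>S\<^esub> h y \<and> h (x \<oplus>\<^bsub>R\<^esub> y) = h x \<oplus>\<^bsub>S\<^esub> h y}"

text \<open>The flag \<open>u\<close> selects the unital (\<open>True\<close>) or the non-unital (\<open>False\<close>) version.\<close>

definition is_ring :: "bool \<Rightarrow> ('a, 'm) ring_scheme \<Rightarrow> bool" where
  "is_ring u R \<longleftrightarrow> (if u then cring R else comm_rng R)"

definition homs :: "bool \<Rightarrow> ('a, 'm) ring_scheme \<Rightarrow> ('b, 'n) ring_scheme \<Rightarrow> ('a \<Rightarrow> 'b) set" where
  "homs u R S = (if u then ring_hom R S else rng_hom R S)"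

text \<open>\<open>rng_pow R a n\<close> is the \<open>n\<close>-th power of \<open>a\<close> for \<open>n \<ge> 1\<close>; it is only used for such \<open>n\<close>.\<close>

definition rng_pow :: "('a, 'm) ring_scheme \<Rightarrow> 'a \<Rightarrow> nat \<Rightarrow> 'a" where
  "rng_pow R a n = ((\<lambda>b. b \<otimes>\<^bsub>R\<^esub> a) ^^ (n - 1)) a"

definition no_torsion :: "nat set \<Rightarrow> ('a, 'm) ring_scheme \<Rightarrow> bool" where
  "no_torsion T R \<longleftrightarrow> (\<forall>n\<in>T. inj_on (\<lambda>a. add_pow R n a) (carrier R))"


section \<open>The category \<open>RF\<^sub>T\<close>\<close>

text \<open>The rings of a system have carriers in a common type; this is no restriction, as the
  members of a set-indexed family of rings all embed into their disjoint union.
  \<open>rf_res A S\<^sub>2 S\<^sub>1\<close> is the transition map from \<open>S\<^sub>2\<close> to \<open>S\<^sub>1\<close>, and \<open>rf_frob A p S\<close> is \<open>F\<^sub>p\<close> on the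
  ring at \<open>S\<close>. Components at sets that are not \<open>\<preceq> T\<close> are irrelevant.\<close>

record 'a rf_system =
  rf_ring :: "nat set \<Rightarrow> 'a ring"
  rf_res :: "nat set \<Rightarrow> nat set \<Rightarrow> 'a \<Rightarrow> 'a"
  rf_frob :: "nat \<Rightarrow> nat set \<Rightarrow> 'a \<Rightarrow> 'a"

text \<open>In \<open>frob_comm\<close>, note that \<open>S \<oslash> p \<oslash> l = S \<oslash> l \<oslash> p = S \<oslash> (p * l)\<close> for \<open>p * l \<in> S\<close> and \<open>S\<close>
  divisor stable.\<close>

locale rf_object =
  fixes u :: bool and T :: "nat set" and A :: "'a rf_system"
  assumes ring: "S \<preceq> T \<Longrightarrow> is_ring u (rf_ring A S)"
    and res_hom: "\<lbrakk>S1 \<preceq> S2; S2 \<preceq> T\<rbrakk> \<Longrightarrow> rf_res A S2 S1 \<in> homs u (rf_ring A S2) (rf_ring A S1)"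
    and res_id: "\<lbrakk>S \<preceq> T; a \<in> carrier (rf_ring A S)\<rbrakk> \<Longrightarrow> rf_res A S S a = a"
    and res_res: "\<lbrakk>S1 \<preceq> S2; S2 \<preceq> S3; S3 \<preceq> T; a \<in> carrier (rf_ring A S3)\<rbrakk>
          \<Longrightarrow> rf_res A S2 S1 (rf_res A S3 S2 a) = rf_res A S3 S1 a"
    and frob_hom: "\<lbrakk>S \<preceq> T; prime p; p \<in> S\<rbrakk>
          \<Longrightarrow> rf_frob A p S \<in> homs u (rf_ring A S) (rf_ring A (S \<oslash> p))"
    and frob_cong: "\<lbrakk>S \<preceq> T; prime p; p \<in> S; a \<in> carrier (rf_ring A S)\<rbrakk>
          \<Longrightarrow> \<exists>b\<in>carrier (rf_ring A (S \<oslash> p)).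
                rf_frob A p S a =
                  rng_pow (rf_ring A (S \<oslash> p)) (rf_res A S (S \<oslash> p) a) p
                    \<oplus>\<^bsub>rf_ring A (S \<oslash> p)\<^esub> add_pow (rf_ring A (S \<oslash> p)) p b"
    and res_frob: "\<lbrakk>S1 \<preceq> S2; S2 \<preceq> T; prime p; p \<in> S1; a \<in> carrier (rf_ring A S2)\<rbrakk>
          \<Longrightarrow> rf_res A (S2 \<oslash> p) (S1 \<oslash> p) (rf_frob A p S2 a) = rf_frob A p S1 (rf_res A S2 S1 a)"
    and frob_comm: "\<lbrakk>S \<preceq> T; prime p; prime l; p * l \<in> S; a \<in> carrier (rf_ring A S)\<rbrakk>
          \<Longrightarrow> rf_frob A l (S \<oslash> p) (rf_frob A p S a) = rf_frob A p (S \<oslash> l) (rf_frob A l S a)"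

locale rf_morphism =
  dom: rf_object u T A + cod: rf_object u T B
  for u :: bool and T :: "nat set" and A :: "'a rf_system" and B :: "'b rf_system" +
  fixes \<phi> :: "nat set \<Rightarrow> 'a \<Rightarrow> 'b"
  assumes hom: "S \<preceq> T \<Longrightarrow> \<phi> S \<in> homs u (rf_ring A S) (rf_ring B S)"
    and res: "\<lbrakk>S1 \<preceq> S2; S2 \<preceq> T; a \<in> carrier (rf_ring A S2)\<rbrakk>
          \<Longrightarrow> \<phi> S1 (rf_res A S2 S1 a) = rf_res B S2 S1 (\<phi> S2 a)"
    and frob: "\<lbrakk>S \<preceq> T; prime p; p \<in> S; a \<in> carrier (rf_ring A S)\<rbrakk>
          \<Longrightarrow> \<phi> (S \<oslash> p) (rf_frob A p S a) = rf_frob B p S (\<phi> S a)"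

text \<open>\<open>F\<^sub>n\<close> applies \<open>F\<^sub>p\<close> successively for the primes \<open>p\<close> dividing \<open>n\<close>, with multiplicity. The order is
  immaterial by \<open>frob_comm\<close>; here it is increasing. The result lies in the ring at
  \<open>S \<oslash> n\<close>, which is the iterated quotient of \<open>S\<close> by these primes.\<close>

fun rf_frob_list :: "'a rf_system \<Rightarrow> nat list \<Rightarrow> nat set \<Rightarrow> 'a \<Rightarrow> 'a" where
  "rf_frob_list A [] S a = a"
| "rf_frob_list A (p # ps) S a = rf_frob_list A ps (S \<oslash> p) (rf_frob A p S a)"

definition rf_frob_nat :: "'a rf_system \<Rightarrow> nat \<Rightarrow> nat set \<Rightarrow> 'a \<Rightarrow> 'a" where
  "rf_frob_nat A n S a =
     rf_frob_list A (sorted_list_of_multiset (prime_factorization n)) S a"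


section \<open>Universal Witt polynomials\<close>

text \<open>Integer polynomials in the variables \<open>X\<^sub>d\<close> (index \<open>Inl d\<close>) and \<open>Y\<^sub>d\<close> (index \<open>Inr d\<close>).\<close>

type_synonym witt_poly = "((nat + nat) \<Rightarrow>\<^sub>0 nat) \<Rightarrow>\<^sub>0 int"

definition wvar :: "nat + nat \<Rightarrow> witt_poly" where
  "wvar i = Poly_Mapping.single (Poly_Mapping.single i 1) 1"

definition ghost_poly :: "(nat \<Rightarrow> witt_poly) \<Rightarrow> nat \<Rightarrow> witt_poly" where
  "ghost_poly c n = (\<Sum>d | d dvd n. of_nat d * c d ^ (n div d))"

text \<open>The polynomials with prescribed ghost components; the value at \<open>0\<close> is a dummy.\<close>

definition witt_coords :: "(nat \<Rightarrow> witt_poly) \<Rightarrow> nat \<Rightarrow> witt_poly" where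
  "witt_coords w = (THE c. c 0 = 0 \<and> (\<forall>n\<ge>1. ghost_poly c n = w n))"

abbreviation (input) "ghost_X \<equiv> ghost_poly (\<lambda>d. wvar (Inl d))"
abbreviation (input) "ghost_Y \<equiv> ghost_poly (\<lambda>d. wvar (Inr d))"

definition witt_add_poly :: "nat \<Rightarrow> witt_poly" where
  "witt_add_poly = witt_coords (\<lambda>n. ghost_X n + ghost_Y n)"

definition witt_mult_poly :: "nat \<Rightarrow> witt_poly" where
  "witt_mult_poly = witt_coords (\<lambda>n. ghost_X n * ghost_Y n)"

definition witt_frob_poly :: "nat \<Rightarrow> nat \<Rightarrow> witt_poly" where
  "witt_frob_poly k = witt_coords (\<lambda>n. ghost_X (k * n))"

text \<open>The polynomials above have zero constant term and so can be evaluated in a non-unital ring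
  \<open>R\<close>. This is done in the unital ring \<open>\<int> \<oplus> R\<close>, where the value has first component \<open>0\<close>.\<close>

definition unitization :: "('a, 'm) ring_scheme \<Rightarrow> (int \<times> 'a) ring" where
  "unitization R =
    \<lparr>carrier = UNIV \<times> carrier R,
     monoid.mult = (\<lambda>(m, a) (n, b). (m * n, add_pow R m b \<oplus>\<^bsub>R\<^esub> add_pow R n a \<oplus>\<^bsub>R\<^esub> a \<otimes>\<^bsub>R\<^esub> b)),
     monoid.one = (1, \<zero>\<^bsub>R\<^esub>),
     ring.zero = (0, \<zero>\<^bsub>R\<^esub>),
     ring.add = (\<lambda>(m, a) (n, b). (m + n, a \<oplus>\<^bsub>R\<^esub> b))\<rparr>"

definition wpoly_eval :: "('c, 'm) ring_scheme \<Rightarrow> (nat + nat \<Rightarrow> 'c) \<Rightarrow> witt_poly \<Rightarrow> 'c" where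
  "wpoly_eval R v f =
     (\<Oplus>\<^bsub>R\<^esub>m\<in>Poly_Mapping.keys f. add_pow R (Poly_Mapping.lookup f m)
        (\<Otimes>\<^bsub>R\<^esub>i\<in>Poly_Mapping.keys m. v i [^]\<^bsub>R\<^esub> Poly_Mapping.lookup m i))"

text \<open>The value of \<open>f\<close> at \<open>X = x\<close>, \<open>Y = y\<close>. Variables with index outside \<open>S\<close>, which do not occur in
  the polynomials used below, are set to zero.\<close>

definition witt_eval ::
    "('a, 'm) ring_scheme \<Rightarrow> nat set \<Rightarrow> (nat \<Rightarrow> 'a) \<Rightarrow> (nat \<Rightarrow> 'a) \<Rightarrow> witt_poly \<Rightarrow> 'a" where
  "witt_eval R S x y f = snd (wpoly_eval (unitization R)
     (case_sum (\<lambda>d. (0, if d \<in> S then x d else \<zero>\<^bsub>R\<^esub>)) (\<lambda>d. (0, if d \<in> S then y d else \<zero>\<^bsub>R\<^esub>))) f)"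


section \<open>Witt vectors\<close>

definition witt_ring :: "('a, 'm) ring_scheme \<Rightarrow> nat set \<Rightarrow> (nat \<Rightarrow> 'a) ring" where
  "witt_ring R S =
    \<lparr>carrier = (\<Pi>\<^sub>E n\<in>S. carrier R),
     monoid.mult = (\<lambda>x y. \<lambda>n\<in>S. witt_eval R S x y (witt_mult_poly n)),
     monoid.one = (\<lambda>n\<in>S. if n = 1 then \<one>\<^bsub>R\<^esub> else \<zero>\<^bsub>R\<^esub>),
     ring.zero = (\<lambda>n\<in>S. \<zero>\<^bsub>R\<^esub>),
     ring.add = (\<lambda>x y. \<lambda>n\<in>S. witt_eval R S x y (witt_add_poly n))\<rparr>"

definition witt_frob :: "('a, 'm) ring_scheme \<Rightarrow> nat \<Rightarrow> nat set \<Rightarrow> (nat \<Rightarrow> 'a) \<Rightarrow> nat \<Rightarrow> 'a" where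
  "witt_frob R k S x = (\<lambda>n\<in>S \<oslash> k. witt_eval R S x x (witt_frob_poly k n))"

definition ghost :: "('a, 'm) ring_scheme \<Rightarrow> nat set \<Rightarrow> (nat \<Rightarrow> 'a) \<Rightarrow> nat \<Rightarrow> 'a" where
  "ghost R S x = (\<lambda>n\<in>S. \<Oplus>\<^bsub>R\<^esub>d\<in>{d. d dvd n}. add_pow R d (rng_pow R (x d) (n div d)))"

definition witt_map :: "('a \<Rightarrow> 'b) \<Rightarrow> nat set \<Rightarrow> (nat \<Rightarrow> 'a) \<Rightarrow> nat \<Rightarrow> 'b" where
  "witt_map h S x = (\<lambda>n\<in>S. h (x n))"

definition witt_system :: "'a ring \<Rightarrow> (nat \<Rightarrow> 'a) rf_system" where
  "witt_system R =
    \<lparr>rf_ring = witt_ring R, rf_res = (\<lambda>S2 S1 x. restrict x S1), rf_frob = witt_frob R\<rparr>"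

text \<open>A morphism to the Witt system of the ring at \<open>{1}\<close> which is the identity at \<open>{1}\<close>, where
  Witt vectors of length one are identified with elements of the ring.\<close>

definition witt_lift ::
    "bool \<Rightarrow> nat set \<Rightarrow> 'a rf_system \<Rightarrow> (nat set \<Rightarrow> 'a \<Rightarrow> nat \<Rightarrow> 'a) \<Rightarrow> bool" where
  "witt_lift u T A \<alpha> \<longleftrightarrow>
     rf_morphism u T A (witt_system (rf_ring A {1})) \<alpha> \<and>
     (\<forall>a\<in>carrier (rf_ring A {1}). \<alpha> {1} a = (\<lambda>n\<in>{1}. a))"

end

theory Submission
  imports Defs
begin

text \<open>
  \<^bold>\<open>Existence.\<close> The formula for the ghost components leaves no choice: since \<open>A\<close> has no
  \<open>T\<close>-torsion, the ghost map is injective (\<open>witt_eqI\<close>), and \<open>\<alpha>\<^sub>S(a)\<close> has to be the Witt vector with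
  ghost components \<open>\<pi> F\<^sub>n(a)\<close>. The point is that this family is in the image of the ghost map.
  This is a form of Dwork's lemma (theorem \<open>dwork\<close>): if elements \<open>w\<^sub>n\<close> of the rings at \<open>S \<oslash> n\<close> satisfy
  \<open>w\<^bsub>p n\<^esub> \<equiv> F\<^sub>p(w\<^sub>n)\<close> modulo the highest power of \<open>p\<close> dividing \<open>p n\<close>, then there are \<open>x\<^sub>n\<close> in the rings at
  \<open>S \<oslash> n\<close> such that \<open>w\<^sub>n\<close> is the sum of \<open>d \<pi>(x\<^sub>d)\<^bsup>n/d\<^esup>\<close> over the divisors \<open>d\<close> of \<open>n\<close>. The
  coordinates are taken in the rings at \<open>S \<oslash> n\<close> instead of \<open>A\<close> because \<open>A\<close> carries no Frobenius map.
  The arithmetic is that \<open>F\<^sub>p(\<pi>(x\<^sub>d)) \<equiv> \<pi>(x\<^sub>d)\<^bsup>p\<^esup>\<close> modulo \<open>p\<close>, and that a congruence \<open>x \<equiv> y\<close> modulo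
  \<open>p\<close> implies \<open>d x\<^bsup>e\<^esup> \<equiv> d y\<^bsup>e\<^esup>\<close> modulo \<open>p\<close> times the highest power of \<open>p\<close> dividing \<open>d e\<close>
  (\<open>scaled_power_diff_dvd\<close>). The theorem applies to \<open>w\<^sub>n = F\<^sub>n(a)\<close>, and projecting to \<open>A\<close> gives
  \<open>\<alpha>\<^sub>S(a)\<close>. That \<open>\<alpha>\<close> is a morphism is then read off from ghost components (\<open>witt_lift_lift\<close>).

  \<^bold>\<open>Uniqueness and functoriality.\<close> The \<open>n\<close>-th ghost component of a Witt vector is the first
  coordinate of its image under \<open>F\<^sub>n\<close>. A morphism that is the identity at \<open>{1}\<close> and commutes with
  \<open>\<pi>\<close> and \<open>F\<^sub>n\<close> therefore sends \<open>a\<close> to a vector with ghost components \<open>\<pi> F\<^sub>n(a)\<close>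
  (\<open>ghost_witt_lift\<close>), and injectivity of the ghost map does the rest.

  \<^bold>\<open>The Witt vectors.\<close> It also has to be shown that the Witt vectors over \<open>A\<close> form an object of \<open>RF\<^sub>T\<close>
  (\<open>rf_object_witt_system\<close>). The integer polynomials in the \<open>X\<^sub>d\<close> and \<open>Y\<^sub>d\<close>, with the endomorphisms
  that raise all variables to the \<open>p\<close>-th power, form an object of \<open>RF\<^sub>T\<close> whose members are all the
  same ring. For it \<open>dwork\<close> shows that the universal polynomials for sums, products, negatives,
  Frobenius maps and the quotients \<open>(F\<^sub>p x - x\<^bsup>p\<^esup>) / p\<close> have integer coefficients. By evaluation, the
  operations on Witt vectors over \<open>A\<close> have the expected ghost components, and the axioms hold
  because they hold for ghost components.

  Powers in rings without unit are handled by evaluating integer polynomials without constant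
  term in \<open>\<int> \<oplus> R\<close> (locale \<open>wpoly_substitution\<close>).\<close>

section \<open>Congruences between powers in commutative rings\<close>

text \<open>Used to pass from divisibility by all prime powers in \<open>n\<close> to divisibility by \<open>n\<close>.\<close>

lemma prime_power_parts_induct:
  fixes n :: nat
  assumes "n > 0" and one: "P 1"
    and mult: "\<And>a b. coprime a b \<Longrightarrow> P a \<Longrightarrow> P b \<Longrightarrow> P (a * b)"
    and part: "\<And>p. prime p \<Longrightarrow> p dvd n \<Longrightarrow> P (p ^ multiplicity p n)"
  shows "P n"
proof -
  have "P (\<Prod>p\<in>X. p ^ multiplicity p n)" if "finite X" "X \<subseteq> prime_factors n" for X
    using that
  proof (induction X rule: finite_induct)
    case (insert q X)
    have q: "prime q" "q dvd n"
      using insert.prems by auto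
    have "coprime q p" if "p \<in> X" for p
      using that insert by (intro primes_coprime) auto
    then have "coprime (q ^ multiplicity q n) (\<Prod>p\<in>X. p ^ multiplicity p n)"
      by (intro prod_coprime_right) (auto intro: coprime_power_left_iff[THEN iffD2])
    with q show ?case
      using insert mult part by auto
  qed (use one in auto)
  from this[of "prime_factors n"] show ?thesis
    using \<open>n > 0\<close> by (simp add: prod_prime_factors)
qed

lemma power_diff_dvd_diff:
  fixes x y :: "'a::comm_ring_1"
  shows "x - y dvd x ^ n - y ^ n"
  by (metis power_diff_sumr2 dvd_triv_left)

text \<open>In the factorization of \<open>x ^ p - y ^ p\<close> into \<open>x - y\<close> and \<open>p\<close> mixed monomials, the latter are all
  congruent to \<open>y ^ (p - 1)\<close> modulo \<open>p\<close>, so their sum contributes one more factor \<open>p\<close>.\<close>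

lemma power_diff_dvd_step:
  fixes x y :: "'a::comm_ring_1"
  assumes "of_nat (p ^ Suc j) dvd x - y"
  shows "of_nat (p ^ Suc (Suc j)) dvd x ^ p - y ^ p"
proof -
  have p_dvd: "of_nat p dvd x - y"
    using assms by (metis dvd_trans dvd_triv_left of_nat_mult power_Suc)
  have "of_nat p dvd y ^ (p - Suc i) * x ^ i - y ^ (p - 1)" if "i < p" for i
  proof -
    have "of_nat p dvd x ^ i - y ^ i"
      using p_dvd power_diff_dvd_diff dvd_trans by blast
    moreover have "p - 1 = (p - Suc i) + i"
      using that by simp
    then have "y ^ (p - Suc i) * x ^ i - y ^ (p - 1) = y ^ (p - Suc i) * (x ^ i - y ^ i)"
      by (metis power_add right_diff_distrib)
    ultimately show ?thesis
      by (simp add: dvd_mult)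
  qed
  then have "of_nat p dvd (\<Sum>i<p. y ^ (p - Suc i) * x ^ i - y ^ (p - 1))"
    by (intro dvd_sum) auto
  then have "of_nat p dvd (\<Sum>i<p. y ^ (p - Suc i) * x ^ i) - of_nat p * y ^ (p - 1)"
    by (simp add: sum_subtractf)
  then have "of_nat p dvd (\<Sum>i<p. y ^ (p - Suc i) * x ^ i)"
    by (metis dvd_triv_left diff_add_cancel dvd_add)
  from mult_dvd_mono[OF assms this] show ?thesis
    by (simp only: power_diff_sumr2 power_Suc2[of p "Suc j"] of_nat_mult)
qed

lemma power_prime_power_diff_dvd:
  fixes x y :: "'a::comm_ring_1"
  assumes "of_nat p dvd x - y"
  shows "of_nat (p ^ Suc j) dvd x ^ (p ^ j) - y ^ (p ^ j)"
proof (induction j)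
  case (Suc j)
  from power_diff_dvd_step[OF this] show ?case
    by (simp only: power_mult[symmetric] power_Suc2[of p j])
qed (use assms in simp)

text \<open>Distribute the \<open>k\<close> factors \<open>p\<close> of \<open>d * e\<close> over \<open>d\<close> and \<open>e\<close>: those of \<open>d\<close> stay in front, and
  the \<open>j\<close> factors of \<open>e\<close> come from raising a congruence modulo \<open>p\<close> to the power \<open>p ^ j\<close>, which
  improves it to one modulo \<open>p ^ (j + 1)\<close>.\<close>

lemma scaled_power_diff_dvd:
  fixes x y :: "'a::comm_ring_1"
  assumes "prime p" "of_nat p dvd x - y" "p ^ k dvd d * e"
  shows "of_nat (p ^ Suc k) dvd of_nat d * (x ^ e - y ^ e)"
proof -
  obtain b c where bc: "p ^ k = b * c" "b dvd d" "c dvd e"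
    using division_decomp[OF assms(3)] by blast
  then obtain j where j: "c = p ^ j"
    using divides_primepow_nat[OF \<open>prime p\<close>] by (metis dvd_triv_right)
  obtain e' where e': "e = p ^ j * e'"
    using bc j by blast
  have "of_nat (p ^ Suc j) dvd x ^ e - y ^ e"
    unfolding e' power_mult
    using power_prime_power_diff_dvd[OF assms(2)] power_diff_dvd_diff dvd_trans by blast
  moreover have "(of_nat b :: 'a) dvd of_nat d"
    using bc(2) by (metis dvdE dvd_triv_left of_nat_mult)
  ultimately have "of_nat b * of_nat (p ^ Suc j) dvd of_nat d * (x ^ e - y ^ e)"
    by (intro mult_dvd_mono)
  moreover have "p ^ Suc k = b * p ^ Suc j"
    by (simp add: bc(1) j)
  ultimately show ?thesis
    by (simp only: of_nat_mult)
qed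

lemma multiplicity_prime_times:
  fixes p m :: nat
  assumes "prime p" "m > 0"
  shows "multiplicity p (p * m) = Suc (multiplicity p m)"
  using assms by (intro multiplicity_times_same) auto

text \<open>Passing from \<open>m\<close> to \<open>p * m\<close> only adds divisors that contain the full power of \<open>p\<close>, because
  otherwise one could cancel a factor \<open>p\<close>.\<close>

lemma prime_power_dvd_new_divisor:
  fixes p m d :: nat
  assumes "prime p" "m > 0" "d dvd p * m" "\<not> d dvd m"
  shows "p ^ multiplicity p (p * m) dvd d"
proof -
  obtain e where e: "p * m = d * e"
    using assms(3) by blast
  have "\<not> p dvd e"
  proof
    assume "p dvd e"
    then obtain f where "e = p * f" ..
    with e have "m = d * f"
      using \<open>prime p\<close> by (simp add: prime_gt_0_nat mult.left_commute)
    with assms(4) show False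
      by simp
  qed
  then have "coprime (p ^ multiplicity p (p * m)) e"
    using \<open>prime p\<close> by (simp add: coprime_power_left_iff prime_imp_coprime)
  moreover have "p ^ multiplicity p (p * m) dvd d * e"
    unfolding e[symmetric] by (rule multiplicity_dvd)
  ultimately show ?thesis
    by (simp add: coprime_dvd_mult_left_iff)
qed

text \<open>The congruence behind Dwork's lemma. The two sums are the ghost sums of \<open>x'\<close> at \<open>m\<close> and of \<open>x\<close> at
  \<open>p * m\<close>. The divisors of \<open>m\<close> are compared by \<open>scaled_power_diff_dvd\<close>, and the remaining terms of
  the second sum vanish modulo \<open>p ^ multiplicity p (p * m)\<close> by \<open>prime_power_dvd_new_divisor\<close>. The
  set \<open>D\<close> is kept flexible because the second sum occurs both with and without the term
  \<open>d = p * m\<close>.\<close>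

lemma ghost_sum_congruence:
  fixes x x' :: "nat \<Rightarrow> 'a::comm_ring_1"
  assumes "prime p" "m > 0"
    and D: "{d. d dvd m} \<subseteq> D" "D \<subseteq> {d. d dvd p * m}"
    and x': "\<And>d. d dvd m \<Longrightarrow> of_nat p dvd x' d - x d ^ p"
  shows "of_nat (p ^ multiplicity p (p * m)) dvd
    (\<Sum>d | d dvd m. of_nat d * x' d ^ (m div d)) - (\<Sum>d\<in>D. of_nat d * x d ^ (p * m div d))"
    (is "?q dvd _")
proof -
  have "p > 0"
    using \<open>prime p\<close> by (simp add: prime_gt_0_nat)
  have "finite D"
    using D(2) finite_divisors_nat[of "p * m"] \<open>m > 0\<close> \<open>p > 0\<close> by (auto intro: finite_subset)
  have split: "(\<Sum>d\<in>D. of_nat d * x d ^ (p * m div d)) =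
      (\<Sum>d\<in>D - {d. d dvd m}. of_nat d * x d ^ (p * m div d)) +
      (\<Sum>d | d dvd m. of_nat d * x d ^ (p * m div d))"
    using D(1) \<open>finite D\<close> by (rule sum.subset_diff)
  have new: "?q dvd of_nat d * x d ^ (p * m div d)" if "d \<in> D - {d. d dvd m}" for d
  proof -
    have "p ^ multiplicity p (p * m) dvd d"
      using that D(2) by (intro prime_power_dvd_new_divisor assms) auto
    then have "?q dvd of_nat d"
      by (metis dvdE dvd_triv_left of_nat_mult)
    then show ?thesis
      by simp
  qed
  have old: "?q dvd of_nat d * x' d ^ (m div d) - of_nat d * x d ^ (p * m div d)"
    if "d dvd m" for d
  proof -
    have "p ^ multiplicity p m dvd d * (m div d)"
      using that by (simp add: multiplicity_dvd)
    from scaled_power_diff_dvd[OF \<open>prime p\<close> x'[OF that] this]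
    have "?q dvd of_nat d * (x' d ^ (m div d) - (x d ^ p) ^ (m div d))"
      by (simp add: multiplicity_prime_times[OF assms(1,2)])
    moreover have "p * m div d = p * (m div d)"
      using that by (rule div_mult_swap[symmetric])
    ultimately show ?thesis
      by (simp add: power_mult right_diff_distrib)
  qed
  have "?q dvd (\<Sum>d | d dvd m. of_nat d * x' d ^ (m div d) - of_nat d * x d ^ (p * m div d)) -
      (\<Sum>d\<in>D - {d. d dvd m}. of_nat d * x d ^ (p * m div d))"
    by (rule dvd_diff; rule dvd_sum) (use new old in auto)
  then show ?thesis
    by (simp only: split sum_subtractf diff_diff_eq add.commute)
qed

text \<open>Characteristic-free form of the fact that the Frobenius map is additive in characteristic \<open>p\<close>.\<close>

lemma freshmans_dream_mod:
  fixes x y :: "'a::comm_ring_1"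
  assumes "prime p"
  shows "of_nat p dvd (x + y) ^ p - (x ^ p + y ^ p)"
proof -
  have "p > 0"
    using assms by (simp add: prime_gt_0_nat)
  let ?t = "\<lambda>k. of_nat (p choose k) * x ^ k * y ^ (p - k)"
  have "{..p} = {0<..<p} \<union> {0, p}"
    using \<open>p > 0\<close> by auto
  then have "(x + y) ^ p = sum ?t ({0<..<p} \<union> {0, p})"
    by (simp add: binomial_ring)
  also have "\<dots> = sum ?t {0<..<p} + sum ?t {0, p}"
    by (intro sum.union_disjoint) auto
  also have "sum ?t {0, p} = x ^ p + y ^ p"
    using \<open>p > 0\<close> by simp
  finally have "(x + y) ^ p - (x ^ p + y ^ p) = sum ?t {0<..<p}"
    by simp
  moreover have "of_nat p dvd ?t k" if "k \<in> {0<..<p}" for k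
  proof -
    have "p dvd p choose k"
      using that assms by (intro dvd_choose_prime) auto
    then have "(of_nat p :: 'a) dvd of_nat (p choose k)"
      by (metis dvdE dvd_triv_left of_nat_mult)
    then show ?thesis
      by simp
  qed
  ultimately show ?thesis
    by (auto intro: dvd_sum)
qed

section \<open>Evaluation of integer polynomials in rings without unit\<close>

lemma add_pow_int_0: "add_pow R (0 :: int) x = \<zero>\<^bsub>R\<^esub>"
  by (simp add: add_pow_def)

context comm_rng begin

lemma r_distr:
  assumes "x \<in> carrier R" "y \<in> carrier R" "z \<in> carrier R"
  shows "z \<otimes> (x \<oplus> y) = z \<otimes> x \<oplus> z \<otimes> y"
  using assms by (metis a_closed l_distr m_comm)

lemma add_pow_mult_left:
  fixes k :: int
  assumes "x \<in> carrier R" "y \<in> carrier R"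
  shows "add_pow R k x \<otimes> y = add_pow R k (x \<otimes> y)"
proof -
  have "(\<lambda>z. z \<otimes> y) \<in> hom (add_monoid R) (add_monoid R)"
    using assms by (auto simp: hom_def m_closed l_distr)
  then show ?thesis
    using hom_int_pow[OF _ _ add.is_group add.is_group, of "\<lambda>z. z \<otimes> y" x k] assms
    by (simp add: add_pow_def)
qed

lemma add_pow_mult_right:
  fixes k :: int
  assumes "x \<in> carrier R" "y \<in> carrier R"
  shows "x \<otimes> add_pow R k y = add_pow R k (x \<otimes> y)"
  using assms by (metis add_pow_mult_left m_comm add.int_pow_closed)

lemma m_lcomm:
  assumes "x \<in> carrier R" "y \<in> carrier R" "z \<in> carrier R"
  shows "x \<otimes> (y \<otimes> z) = y \<otimes> (x \<otimes> z)"
  using assms by (metis m_assoc m_comm)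

lemma r_null:
  assumes "x \<in> carrier R"
  shows "x \<otimes> \<zero> = \<zero>"
  using add_pow_mult_right[of x \<zero> 0] assms by (simp add: m_closed add_pow_int_0)

lemma l_null:
  assumes "x \<in> carrier R"
  shows "\<zero> \<otimes> x = \<zero>"
  using assms by (metis r_null m_comm zero_closed)

text \<open>Since \<open>\<int> \<oplus> R\<close> is a unital ring, polynomials can be evaluated in it,
  although \<open>R\<close> itself need not have a unit.\<close>

lemma cring_unitization: "cring (unitization R)"
proof (rule cringI)
  show "abelian_group (unitization R)"
  proof (rule abelian_groupI)
    fix x assume "x \<in> carrier (unitization R)"
    then obtain m a where x: "x = (m, a)" "a \<in> carrier R"
      by (auto simp: unitization_def)
    then show "\<exists>y\<in>carrier (unitization R). y \<oplus>\<^bsub>unitization R\<^esub> x = \<zero>\<^bsub>unitization R\<^esub>"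
      by (intro bexI[of _ "(- m, \<ominus> a)"]) (auto simp: unitization_def l_neg)
  qed (auto simp: unitization_def a_ac)
  show "comm_monoid (unitization R)"
    by (rule comm_monoidI)
       (auto simp: unitization_def m_closed m_assoc r_null l_null l_distr r_distr m_comm add_pow_mult_left
         add_pow_mult_right add.int_pow_distrib add.int_pow_pow a_ac m_lcomm algebra_simps)
qed (auto simp: unitization_def m_closed l_distr r_distr add.int_pow_distrib add.int_pow_mult a_ac algebra_simps)

end

lemma poly_mapping_add_induct [case_names zero single add]:
  fixes f :: "'a \<Rightarrow>\<^sub>0 'b::comm_monoid_add"
  assumes zero: "P 0"
    and single: "\<And>m c. P (Poly_Mapping.single m c)"
    and add: "\<And>f g. P f \<Longrightarrow> P g \<Longrightarrow> P (f + g)"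
  shows "P f"
proof -
  have "P (\<Sum>m\<in>K. Poly_Mapping.single m (Poly_Mapping.lookup f m))" if "finite K" for K
    using that by (induction K rule: finite_induct) (auto intro: assms)
  moreover have "f = (\<Sum>m\<in>Poly_Mapping.keys f. Poly_Mapping.single m (Poly_Mapping.lookup f m))"
    by (rule poly_mapping_eqI)
       (auto simp: lookup_sum lookup_single when_def sum.delta' not_in_keys_iff_lookup_eq_zero)
  ultimately show ?thesis
    by (metis finite_keys)
qed

lemma wvar_power: "wvar i ^ k = Poly_Mapping.single (Poly_Mapping.single i k) 1"
  by (induction k) (auto simp: wvar_def mult_single simp flip: single_add)

text \<open>The polynomial ring is generated as a ring by the variables. Statements about ring
  endomorphisms of it thus need to be checked on variables only.\<close>

lemma witt_poly_induct [case_names one var diff mult]: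
  fixes f :: witt_poly
  assumes one: "P 1"
    and var: "\<And>i. P (wvar i)"
    and diff: "\<And>f g. P f \<Longrightarrow> P g \<Longrightarrow> P (f - g)"
    and mult: "\<And>f g. P f \<Longrightarrow> P g \<Longrightarrow> P (f * g)"
  shows "P f"
proof -
  have zero: "P 0"
    using diff[OF one one] by simp
  have minus: "P (- f)" if "P f" for f
    using diff[OF zero that] by simp
  have add: "P (f + g)" if "P f" "P g" for f g
    using diff[OF that(1) minus[OF that(2)]] by simp
  have nat: "P (of_nat k)" for k
    by (induction k) (auto intro: add one zero)
  have int: "P (of_int c)" for c
    by (cases c rule: int_cases2) (use nat minus in \<open>auto simp: of_int_minus\<close>)
  have power: "P (f ^ k)" if "P f" for f k
    by (induction k) (auto intro: that one mult)
  have monomial: "P (Poly_Mapping.single m 1)" for m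
  proof (induction m rule: poly_mapping_add_induct)
    case (single i k)
    show ?case
      using power[OF var, of i k] by (simp add: wvar_power)
  next
    case (add m m')
    then show ?case
      using mult[of "Poly_Mapping.single m 1" "Poly_Mapping.single m' 1"] by (simp add: mult_single)
  qed (use one in simp)
  show ?thesis
  proof (induction f rule: poly_mapping_add_induct)
    case (single m c)
    have "P (of_int c * Poly_Mapping.single m 1)"
      using int monomial mult by blast
    also have "of_int c * Poly_Mapping.single m 1 = Poly_Mapping.single m c"
      using mult_single[of 0 c m 1] by (metis single_of_int of_int_eq_id id_apply add_0 mult_1_right)
    finally show ?case .
  qed (use zero add in auto)
qed

context cring begin

context
  fixes v :: "nat + nat \<Rightarrow> 'a"
  assumes v_closed: "\<And>i. v i \<in> carrier R"
begin

abbreviation "monomial_eval m \<equiv>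
  \<Otimes>i\<in>Poly_Mapping.keys m. v i [^] (Poly_Mapping.lookup m i :: nat)"

lemma monomial_eval_closed: "monomial_eval m \<in> carrier R"
  by (simp add: v_closed)

lemma monomial_eval_superset:
  assumes "finite K" "Poly_Mapping.keys m \<subseteq> K"
  shows "monomial_eval m = (\<Otimes>i\<in>K. v i [^] Poly_Mapping.lookup m i)"
  using assms
  by (intro finprod_mono_neutral_cong_left) (auto simp: v_closed not_in_keys_iff_lookup_eq_zero)

lemma monomial_eval_add: "monomial_eval (m + m') = monomial_eval m \<otimes> monomial_eval m'"
proof -
  let ?K = "Poly_Mapping.keys m \<union> Poly_Mapping.keys m'"
  have "monomial_eval (m + m') =
      (\<Otimes>i\<in>?K. v i [^] Poly_Mapping.lookup m i \<otimes> v i [^] Poly_Mapping.lookup m' i)"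
    by (subst monomial_eval_superset[of ?K]) (simp_all add: keys_add lookup_add nat_pow_mult v_closed)
  then show ?thesis
    by (simp add: monomial_eval_superset[of ?K] v_closed)
qed

lemma wpoly_eval_closed: "wpoly_eval R v f \<in> carrier R"
  unfolding wpoly_eval_def by (intro finsum_closed) (auto simp: monomial_eval_closed)

lemma wpoly_eval_superset:
  assumes "finite K" "Poly_Mapping.keys f \<subseteq> K"
  shows "wpoly_eval R v f = (\<Oplus>m\<in>K. add_pow R (Poly_Mapping.lookup f m) (monomial_eval m))"
  unfolding wpoly_eval_def using assms
  by (intro add.finprod_mono_neutral_cong_left)
     (auto simp: monomial_eval_closed not_in_keys_iff_lookup_eq_zero add_pow_int_0)

lemma wpoly_eval_single:
  "wpoly_eval R v (Poly_Mapping.single m c) = add_pow R c (monomial_eval m)"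
  by (simp add: wpoly_eval_superset[of "{m}"] monomial_eval_closed)

lemma wpoly_eval_zero: "wpoly_eval R v 0 = \<zero>"
  by (simp add: wpoly_eval_def)

lemma wpoly_eval_one: "wpoly_eval R v 1 = \<one>"
  using wpoly_eval_single[of 0 1] by simp

lemma wpoly_eval_add: "wpoly_eval R v (f + g) = wpoly_eval R v f \<oplus> wpoly_eval R v g"
proof -
  let ?K = "Poly_Mapping.keys f \<union> Poly_Mapping.keys g"
  have "wpoly_eval R v (f + g) = (\<Oplus>m\<in>?K. add_pow R (Poly_Mapping.lookup f m) (monomial_eval m) \<oplus>
      add_pow R (Poly_Mapping.lookup g m) (monomial_eval m))"
    by (simp add: wpoly_eval_superset[of ?K] keys_add lookup_add add.int_pow_mult monomial_eval_closed)
  then show ?thesis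
    by (simp add: wpoly_eval_superset[of ?K] monomial_eval_closed)
qed

lemma wpoly_eval_mult: "wpoly_eval R v (f * g) = wpoly_eval R v f \<otimes> wpoly_eval R v g"
proof (induction f rule: poly_mapping_add_induct)
  case (single m c)
  show ?case
  proof (induction g rule: poly_mapping_add_induct)
    case (single m' c')
    show ?case
      by (simp add: mult_single wpoly_eval_single monomial_eval_add monomial_eval_closed
          add_pow_ldistr_int add_pow_rdistr_int add.int_pow_pow mult.commute m_comm)
  qed (auto simp: wpoly_eval_zero wpoly_eval_add wpoly_eval_closed ring_distribs r_distr)
qed (auto simp: wpoly_eval_zero wpoly_eval_add wpoly_eval_closed ring_distribs l_distr)

lemma wpoly_eval_wvar: "wpoly_eval R v (wvar i) = v i"
  by (simp add: wvar_def wpoly_eval_single v_closed)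

end

end

lemma rng_pow_1 [simp]: "rng_pow R a 1 = a" "rng_pow R a (Suc 0) = a"
  by (simp_all add: rng_pow_def)

lemma rng_pow_Suc: "n > 0 \<Longrightarrow> rng_pow R a (Suc n) = rng_pow R a n \<otimes>\<^bsub>R\<^esub> a"
  by (cases n) (simp_all add: rng_pow_def)

lemma (in comm_rng) rng_pow_closed:
  assumes "a \<in> carrier R" "n > 0"
  shows "rng_pow R a n \<in> carrier R"
  using \<open>n > 0\<close> by (induction n rule: nat_induct_non_zero)
    (auto simp: rng_pow_Suc m_closed assms(1))

lemma finite_divisors: "n > 0 \<Longrightarrow> finite {d::nat. d dvd n}"
  by (simp add: finite_divisors_nat)

lemma div_divisor_pos: "n > 0 \<Longrightarrow> d dvd n \<Longrightarrow> n div d > (0::nat)"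
  by (rule Nat.gr0I) (simp add: dvd_div_eq_0_iff)

lemma sum_divisors_split:
  "n > 0 \<Longrightarrow> {d::nat. d dvd n} = insert n {d. d dvd n \<and> d < n}"
  using dvd_imp_le by (fastforce simp: order.order_iff_strict)

text \<open>Substitution of elements of a possibly non-unital ring \<open>R\<close> for the variables. The value lies in
  \<open>\<int> \<oplus> R\<close>; its component \<open>const f\<close> in \<open>\<int>\<close> is the constant term of \<open>f\<close>, and on the ideal of
  polynomials without constant term the component \<open>ev f\<close> in \<open>R\<close> is multiplicative. In this way,
  identities and divisibilities between integer polynomials are transported to \<open>R\<close>.\<close>

locale wpoly_substitution = comm_rng R for R (structure) +
  fixes v :: "nat + nat \<Rightarrow> 'a"
  assumes v_closed: "v i \<in> carrier R"
begin

definition ueval :: "witt_poly \<Rightarrow> int \<times> 'a" where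
  "ueval = wpoly_eval (unitization R) (\<lambda>i. (0, v i))"

abbreviation "ev f \<equiv> snd (ueval f)"
abbreviation "const f \<equiv> fst (ueval f)"

sublocale U: cring "unitization R"
  by (rule cring_unitization)

lemma uv_closed: "(0, v i) \<in> carrier (unitization R)"
  by (simp add: unitization_def v_closed)

lemma ev_closed: "ev f \<in> carrier R"
  using U.wpoly_eval_closed[of "\<lambda>i. (0, v i)" f, OF uv_closed]
  by (simp add: ueval_def unitization_def mem_Times_iff)

lemma ueval_add: "ueval (f + g) = (const f + const g, ev f \<oplus> ev g)"
  using U.wpoly_eval_add[of "\<lambda>i. (0, v i)" f g, OF uv_closed]
  by (simp add: ueval_def unitization_def case_prod_beta)

lemma ueval_mult:
  "ueval (f * g) = (const f * const g,
     add_pow R (const f) (ev g) \<oplus> add_pow R (const g) (ev f) \<oplus> ev f \<otimes> ev g)"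
  using U.wpoly_eval_mult[of "\<lambda>i. (0, v i)" f g, OF uv_closed]
  by (simp add: ueval_def unitization_def case_prod_beta)

lemma ueval_zero: "ueval 0 = (0, \<zero>)"
  using U.wpoly_eval_zero[of "\<lambda>i. (0, v i)", OF uv_closed] by (simp add: ueval_def unitization_def)

lemma ueval_one: "ueval 1 = (1, \<zero>)"
  using U.wpoly_eval_one[of "\<lambda>i. (0, v i)", OF uv_closed] by (simp add: ueval_def unitization_def)

lemma ueval_wvar: "ueval (wvar i) = (0, v i)"
  using U.wpoly_eval_wvar[of "\<lambda>i. (0, v i)" i, OF uv_closed] by (simp add: ueval_def)

lemma const_of_nat: "const (of_nat k) = int k"
  by (induction k) (auto simp: ueval_zero ueval_one ueval_add)

lemma const_add: "const (f + g) = const f + const g"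
  by (simp add: ueval_add)

lemma const_mult: "const (f * g) = const f * const g"
  by (simp add: ueval_mult)

lemma const_power: "const (f ^ k) = const f ^ k"
  by (induction k) (auto simp: ueval_one const_mult)

lemma const_sum: "const (sum f K) = (\<Sum>k\<in>K. const (f k))"
  by (induction K rule: infinite_finite_induct) (auto simp: ueval_zero const_add)

lemma const_uminus: "const (- f) = - const f"
  using const_add[of f "- f"] by (simp add: ueval_zero)

lemma const_wvar: "const (wvar i) = 0"
  by (simp add: ueval_wvar)

lemma ev_wvar: "ev (wvar i) = v i"
  by (simp add: ueval_wvar)

lemma ev_add: "ev (f + g) = ev f \<oplus> ev g"
  by (simp add: ueval_add)

lemma ev_mult:
  assumes "const f = 0" "const g = 0"
  shows "ev (f * g) = ev f \<otimes> ev g"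
  by (simp add: ueval_mult assms add_pow_int_0 ev_closed m_closed)

lemma ev_power:
  assumes "const f = 0" "k > 0"
  shows "ev (f ^ k) = rng_pow R (ev f) k"
  using \<open>k > 0\<close>
proof (induction k rule: nat_induct_non_zero)
  case (Suc k)
  then show ?case
    using ev_mult[of "f ^ k" f] by (simp add: const_power assms power_Suc2 rng_pow_Suc del: power_Suc)
qed simp

lemma ev_sum: "ev (sum f K) = (\<Oplus>k\<in>K. ev (f k))"
  by (induction K rule: infinite_finite_induct) (auto simp: ueval_zero ev_add ev_closed)

lemma ev_of_nat_mult: "ev (of_nat k * f) = add_pow R k (ev f)"
proof (induction k)
  case (Suc k)
  have "of_nat (Suc k) * f = of_nat k * f + f"
    by (simp add: algebra_simps)
  with Suc show ?case
    by (simp only: ev_add) (simp add: ev_closed)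
qed (simp add: ueval_zero)

lemma const_ghost_poly: "const (ghost_poly c n) = (\<Sum>d | d dvd n. int d * const (c d) ^ (n div d))"
  by (simp add: ghost_poly_def const_sum const_mult const_of_nat const_power)

text \<open>The constant terms of the \<open>c n\<close> satisfy the ghost equations over \<open>\<int>\<close> with right-hand side \<open>0\<close>,
  whose only solution is \<open>0\<close>. This makes the universal polynomials evaluable in non-unital rings.\<close>

lemma const_coordinate_zero:
  assumes "\<And>n. n > 0 \<Longrightarrow> const (ghost_poly c n) = 0" "n > 0"
  shows "const (c n) = 0"
  using \<open>n > 0\<close>
proof (induction n rule: less_induct)
  case (less n)
  have "0 = (\<Sum>d | d dvd n. int d * const (c d) ^ (n div d))"
    using assms(1)[OF \<open>n > 0\<close>] by (simp add: const_ghost_poly)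
  also have "\<dots> = int n * const (c n) + (\<Sum>d | d dvd n \<and> d < n. int d * const (c d) ^ (n div d))"
    unfolding sum_divisors_split[OF less.prems]
    by (subst sum.insert) (use less.prems in auto)
  also have "(\<Sum>d | d dvd n \<and> d < n. int d * const (c d) ^ (n div d)) = 0"
  proof (intro sum.neutral ballI)
    fix d assume "d \<in> {d. d dvd n \<and> d < n}"
    then have d: "d < n" "d dvd n"
      by auto
    then have "d > 0" "n div d > 0"
      using less.prems dvd_pos_nat div_divisor_pos by blast+
    moreover have "const (c d) = 0"
      using d(1) \<open>d > 0\<close> by (rule less.IH)
    ultimately show "int d * const (c d) ^ (n div d) = 0"
      by simp
  qed
  finally show ?case
    using less.prems by simp
qed

lemma ev_ghost_poly:
  assumes "n > 0" "\<And>d. d dvd n \<Longrightarrow> const (c d) = 0"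
  shows "ev (ghost_poly c n) = (\<Oplus>d\<in>{d. d dvd n}. add_pow R d (rng_pow R (ev (c d)) (n div d)))"
  unfolding ghost_poly_def ev_sum
  by (rule finsum_cong') (use assms in \<open>auto simp: ev_of_nat_mult ev_power div_divisor_pos rng_pow_closed ev_closed\<close>)

end

section \<open>Divisor stable sets and composites of Frobenius maps\<close>

lemma one_mem_divisor_stable: "divisor_stable S \<Longrightarrow> 1 \<in> S"
  unfolding divisor_stable_def by (metis ex_in_conv one_dvd)

lemma divisor_stable_pos: "divisor_stable S \<Longrightarrow> n \<in> S \<Longrightarrow> n > 0"
  unfolding divisor_stable_def by (metis gr0I)

lemma divisor_stable_dvd: "divisor_stable S \<Longrightarrow> n \<in> S \<Longrightarrow> d dvd n \<Longrightarrow> d \<in> S"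
  unfolding divisor_stable_def by blast

lemma mem_ds_quot: "divisor_stable S \<Longrightarrow> \<nu> \<in> S \<oslash> n \<longleftrightarrow> \<nu> * n \<in> S"
  unfolding ds_quot_def using divisor_stable_dvd by auto

lemma divisor_stable_quot:
  assumes "divisor_stable S" "n \<in> S"
  shows "divisor_stable (S \<oslash> n)"
  unfolding divisor_stable_def
proof (intro conjI ballI allI impI)
  show "S \<oslash> n \<noteq> {}"
    using assms by (metis mem_ds_quot empty_iff mult_1)
  show "0 \<notin> S \<oslash> n"
    using assms by (auto simp: ds_quot_def divisor_stable_def)
  show "d \<in> S \<oslash> n" if "m \<in> S \<oslash> n" "d dvd m" for m d
    using that assms by (meson divisor_stable_dvd mem_ds_quot mult_dvd_mono dvd_refl)
qed

lemma ds_quot_quot: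
  assumes "divisor_stable S"
  shows "S \<oslash> m \<oslash> n = S \<oslash> (m * n)"
proof -
  have "\<nu> \<in> S \<and> \<nu> * m \<in> S \<and> \<nu> * n \<in> S" if "\<nu> * (m * n) \<in> S" for \<nu>
    using divisor_stable_dvd[OF assms that] by auto
  then show ?thesis
    by (auto simp: ds_quot_def ac_simps)
qed

lemma ds_quot_1 [simp]: "S \<oslash> 1 = S" "S \<oslash> Suc 0 = S"
  by (auto simp: ds_quot_def)

lemma ds_subset_stable: "S \<preceq> T \<Longrightarrow> divisor_stable S"
  by (simp add: ds_subset_def)

lemma ds_subset_trans: "R \<preceq> S \<Longrightarrow> S \<preceq> T \<Longrightarrow> R \<preceq> T"
  by (auto simp: ds_subset_def)

lemma ds_quot_subset: "S \<preceq> T \<Longrightarrow> n \<in> S \<Longrightarrow> S \<oslash> n \<preceq> T"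
  using divisor_stable_quot by (auto simp: ds_subset_def ds_quot_def)

lemma ds_quot_subset_self: "divisor_stable S \<Longrightarrow> n \<in> S \<Longrightarrow> S \<oslash> n \<preceq> S"
  using divisor_stable_quot by (auto simp: ds_subset_def ds_quot_def)

lemma ds_quot_mono: "R \<preceq> S \<Longrightarrow> n \<in> R \<Longrightarrow> R \<oslash> n \<preceq> S \<oslash> n"
  using divisor_stable_quot by (auto simp: ds_subset_def ds_quot_def)

lemma ds_quot_antimono:
  assumes "divisor_stable S" "n \<in> S" "m dvd n"
  shows "S \<oslash> n \<preceq> S \<oslash> m"
proof -
  have "\<nu> \<in> S \<oslash> m" if "\<nu> \<in> S \<oslash> n" for \<nu>
    using that assms by (meson divisor_stable_dvd mem_ds_quot mult_dvd_mono dvd_refl)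
  with assms show ?thesis
    by (auto simp: ds_subset_def divisor_stable_quot)
qed

lemma singleton_ds_subset: "divisor_stable S \<Longrightarrow> {1} \<preceq> S"
  using one_mem_divisor_stable by (auto simp: ds_subset_def divisor_stable_def)

lemma rng_homD:
  assumes "h \<in> rng_hom R S"
  shows "a \<in> carrier R \<Longrightarrow> h a \<in> carrier S"
    and "a \<in> carrier R \<Longrightarrow> b \<in> carrier R \<Longrightarrow> h (a \<oplus>\<^bsub>R\<^esub> b) = h a \<oplus>\<^bsub>S\<^esub> h b"
    and "a \<in> carrier R \<Longrightarrow> b \<in> carrier R \<Longrightarrow> h (a \<otimes>\<^bsub>R\<^esub> b) = h a \<otimes>\<^bsub>S\<^esub> h b"
  using assms by (auto simp: rng_hom_def)

text \<open>This description, and \<open>is_ring_iff\<close> below, isolate the conditions on the unit, so that the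
  unital and the non-unital version are treated together.\<close>

lemma homs_iff: "h \<in> homs u R S \<longleftrightarrow> h \<in> rng_hom R S \<and> (u \<longrightarrow> h \<one>\<^bsub>R\<^esub> = \<one>\<^bsub>S\<^esub>)"
  by (auto simp: homs_def rng_hom_def ring_hom_def)

lemma homs_comp:
  assumes "g \<in> homs u R S" "h \<in> homs u S Q"
  shows "(\<lambda>a. h (g a)) \<in> homs u R Q"
  using assms by (auto simp: homs_iff rng_hom_def Pi_def)

lemma is_ring_iff:
  "is_ring u R \<longleftrightarrow> comm_rng R \<and> (u \<longrightarrow> \<one>\<^bsub>R\<^esub> \<in> carrier R \<and> (\<forall>a\<in>carrier R. \<one>\<^bsub>R\<^esub> \<otimes>\<^bsub>R\<^esub> a = a))"
proof -
  have "comm_rng R" if "cring R"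
  proof -
    interpret cring R by fact
    show ?thesis
      by unfold_locales (auto intro: m_assoc m_comm l_distr)
  qed
  moreover have "\<one>\<^bsub>R\<^esub> \<in> carrier R" "\<one>\<^bsub>R\<^esub> \<otimes>\<^bsub>R\<^esub> a = a" if "cring R" "a \<in> carrier R" for a
    using that by (auto intro: cring.cring_simprules)
  moreover have "\<one>\<^bsub>R\<^esub> \<in> carrier R" if "cring R"
    using that by (auto intro: cring.cring_simprules)
  moreover have "cring R"
    if "comm_rng R" "\<one>\<^bsub>R\<^esub> \<in> carrier R" "\<forall>a\<in>carrier R. \<one>\<^bsub>R\<^esub> \<otimes>\<^bsub>R\<^esub> a = a"
  proof -
    interpret comm_rng R by fact
    show ?thesis
      using that(2,3)
      by (intro cringI comm_monoidI) (auto intro: m_closed m_assoc m_comm l_distr abelian_group_axioms)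
  qed
  ultimately show ?thesis
    unfolding is_ring_def by auto
qed

locale comm_rng_hom = dom: comm_rng R + cod: comm_rng S
  for R (structure) and S (structure) +
  fixes h
  assumes hom: "h \<in> rng_hom R S"
begin

lemmas closed = rng_homD(1)[OF hom]
  and add = rng_homD(2)[OF hom]
  and mult = rng_homD(3)[OF hom]

lemma zero: "h \<zero>\<^bsub>R\<^esub> = \<zero>\<^bsub>S\<^esub>"
proof -
  have "h \<zero>\<^bsub>R\<^esub> \<oplus>\<^bsub>S\<^esub> h \<zero>\<^bsub>R\<^esub> = h \<zero>\<^bsub>R\<^esub>"
    using add[of "\<zero>\<^bsub>R\<^esub>" "\<zero>\<^bsub>R\<^esub>"] by simp
  then show ?thesis
    by (simp add: closed)
qed

lemma add_pow:
  fixes k :: nat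
  assumes "a \<in> carrier R"
  shows "h (add_pow R k a) = add_pow S k (h a)"
  by (induction k) (auto simp: zero add assms)

lemma rng_pow:
  assumes "a \<in> carrier R" "k > 0"
  shows "h (rng_pow R a k) = rng_pow S (h a) k"
  using \<open>k > 0\<close>
proof (induction k rule: nat_induct_non_zero)
  case 1
  then show ?case by (simp add: rng_pow_def)
next
  case (Suc k)
  then show ?case
    using assms(1) by (simp add: rng_pow_Suc mult dom.rng_pow_closed)
qed

lemma finsum:
  assumes "\<And>i. i \<in> K \<Longrightarrow> f i \<in> carrier R"
  shows "h (\<Oplus>\<^bsub>R\<^esub>i\<in>K. f i) = (\<Oplus>\<^bsub>S\<^esub>i\<in>K. h (f i))"
  using assms
proof (induction K rule: infinite_finite_induct)
  case (insert i K)
  then show ?case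
    by (auto simp: Pi_def add closed)
qed (auto simp: zero)

end

lemma prime_factorization_prime_times:
  fixes p n :: nat
  assumes "prime p" "n > 0"
  shows "prime_factorization (p * n) = add_mset p (prime_factorization n)"
  using assms by (subst prime_factorization_mult) (auto simp: prime_factorization_prime)

lemma factor_list:
  fixes n :: nat
  assumes "n > 0"
  defines "ps \<equiv> sorted_list_of_multiset (prime_factorization n)"
  shows "\<forall>q\<in>set ps. prime q" "prod_list ps = n"
  using assms(1) by (auto simp: ps_def prod_mset_prime_factorization_nat simp flip: prod_mset_prod_list)

context rf_object begin

lemma rng: "S \<preceq> T \<Longrightarrow> comm_rng (rf_ring A S)"
  using ring by (simp add: is_ring_iff)

lemma res_rng_hom: "S1 \<preceq> S2 \<Longrightarrow> S2 \<preceq> T \<Longrightarrow> rf_res A S2 S1 \<in> rng_hom (rf_ring A S2) (rf_ring A S1)"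
  using res_hom by (simp add: homs_iff)

lemma frob_rng_hom:
  "S \<preceq> T \<Longrightarrow> prime p \<Longrightarrow> p \<in> S \<Longrightarrow> rf_frob A p S \<in> rng_hom (rf_ring A S) (rf_ring A (S \<oslash> p))"
  using frob_hom by (simp add: homs_iff)

lemma res_closed:
  "S1 \<preceq> S2 \<Longrightarrow> S2 \<preceq> T \<Longrightarrow> a \<in> carrier (rf_ring A S2) \<Longrightarrow> rf_res A S2 S1 a \<in> carrier (rf_ring A S1)"
  by (rule rng_homD(1)[OF res_rng_hom])

lemma frob_closed:
  "S \<preceq> T \<Longrightarrow> prime p \<Longrightarrow> p \<in> S \<Longrightarrow> a \<in> carrier (rf_ring A S) \<Longrightarrow>
    rf_frob A p S a \<in> carrier (rf_ring A (S \<oslash> p))"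
  by (rule rng_homD(1)[OF frob_rng_hom])

lemma frob_list_hom:
  assumes "S \<preceq> T" "\<forall>p\<in>set ps. prime p" "prod_list ps \<in> S"
  shows "rf_frob_list A ps S \<in> homs u (rf_ring A S) (rf_ring A (S \<oslash> prod_list ps))"
  using assms
proof (induction ps arbitrary: S)
  case Nil
  then show ?case
    by (auto simp: homs_iff rng_hom_def)
next
  case (Cons p ps)
  have S: "divisor_stable S"
    using Cons.prems ds_subset_stable by blast
  have p: "prime p" "p \<in> S"
    using Cons.prems divisor_stable_dvd[OF S] by auto
  have "rf_frob_list A ps (S \<oslash> p) \<in>
      homs u (rf_ring A (S \<oslash> p)) (rf_ring A (S \<oslash> p \<oslash> prod_list ps))"
    using Cons.prems p S by (intro Cons.IH) (auto simp: ds_quot_subset mem_ds_quot mult.commute)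
  from homs_comp[OF frob_hom[OF Cons.prems(1) p] this] show ?case
    by (simp add: ds_quot_quot[OF S])
qed

text \<open>Move \<open>F\<^sub>p\<close> past the maps in the list one at a time; each step is \<open>frob_comm\<close>. Divisor stability
  provides the membership \<open>p * q \<in> S\<close> that \<open>frob_comm\<close> demands.\<close>

lemma frob_list_frob:
  assumes "S \<preceq> T" "prime p" "\<forall>q\<in>set ps. prime q" "p * prod_list ps \<in> S"
    "a \<in> carrier (rf_ring A S)"
  shows "rf_frob_list A ps (S \<oslash> p) (rf_frob A p S a) =
    rf_frob A p (S \<oslash> prod_list ps) (rf_frob_list A ps S a)"
  using assms
proof (induction ps arbitrary: S a)
  case (Cons q ps)
  have S: "divisor_stable S"
    using Cons.prems ds_subset_stable by blast
  have "p * q \<in> S"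
    by (rule divisor_stable_dvd[OF S Cons.prems(4)]) (simp add: mult_dvd_mono)
  moreover have q: "q \<in> S" "prime q"
    using divisor_stable_dvd[OF S Cons.prems(4)] Cons.prems by auto
  ultimately have "rf_frob_list A (q # ps) (S \<oslash> p) (rf_frob A p S a) =
      rf_frob_list A ps (S \<oslash> q \<oslash> p) (rf_frob A p (S \<oslash> q) (rf_frob A q S a))"
    using Cons.prems frob_comm[of S p q a] by (simp add: ds_quot_quot[OF S] mult.commute)
  also have "\<dots> = rf_frob A p (S \<oslash> q \<oslash> prod_list ps) (rf_frob_list A ps (S \<oslash> q) (rf_frob A q S a))"
    using Cons.prems q
    by (intro Cons.IH) (auto simp: ds_quot_subset mem_ds_quot S frob_closed ac_simps)
  finally show ?case
    by (simp add: ds_quot_quot[OF S])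
qed simp

lemma frob_list_remove1:
  assumes "S \<preceq> T" "\<forall>q\<in>set ps. prime q" "prod_list ps \<in> S" "a \<in> carrier (rf_ring A S)" "p \<in> set ps"
  shows "rf_frob_list A ps S a = rf_frob_list A (remove1 p ps) (S \<oslash> p) (rf_frob A p S a)"
  using assms
proof (induction ps arbitrary: S a)
  case (Cons q ps)
  have S: "divisor_stable S"
    using Cons.prems ds_subset_stable by blast
  show ?case
  proof (cases "p = q")
    case False
    with Cons.prems have p: "p \<in> set ps" "prime p"
      by auto
    then have "p dvd prod_list ps"
      by (auto dest!: split_list)
    then have "p * q \<in> S"
      using divisor_stable_dvd[OF S Cons.prems(3)] by (simp add: mult.commute mult_dvd_mono)
    moreover have q: "q \<in> S" "prime q"
      using divisor_stable_dvd[OF S Cons.prems(3)] Cons.prems by auto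
    moreover have "rf_frob_list A (q # ps) S a =
        rf_frob_list A (remove1 p ps) (S \<oslash> q \<oslash> p) (rf_frob A p (S \<oslash> q) (rf_frob A q S a))"
      using Cons.prems q p
      by simp (intro Cons.IH, auto simp: ds_quot_subset mem_ds_quot S frob_closed ac_simps)
    ultimately show ?thesis
      using Cons.prems False p frob_comm[of S p q a] by (simp add: ds_quot_quot[OF S] mult.commute)
  qed simp
qed simp

text \<open>The composite of the \<open>F\<^sub>p\<close> depends only on the multiset of primes, which makes \<open>F\<^sub>n\<close> multiplicative in \<open>n\<close>
  although it was defined with the primes in increasing order.\<close>

lemma frob_list_perm:
  assumes "S \<preceq> T" "\<forall>q\<in>set ps. prime q" "prod_list ps \<in> S" "a \<in> carrier (rf_ring A S)"
    "mset ps = mset qs"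
  shows "rf_frob_list A ps S a = rf_frob_list A qs S a"
  using assms
proof (induction ps arbitrary: S a qs)
  case (Cons p ps)
  have S: "divisor_stable S"
    using Cons.prems ds_subset_stable by blast
  have p: "prime p" "p \<in> S"
    using divisor_stable_dvd[OF S Cons.prems(3)] Cons.prems by auto
  have "p \<in> set qs"
    using Cons.prems(5) by (metis list.set_intros(1) set_mset_mset)
  moreover have "set qs = set (p # ps)" "prod_list qs = prod_list (p # ps)"
    using Cons.prems(5) by (metis set_mset_mset, metis prod_mset_prod_list)
  ultimately have "rf_frob_list A qs S a = rf_frob_list A (remove1 p qs) (S \<oslash> p) (rf_frob A p S a)"
    using Cons.prems by (intro frob_list_remove1) auto
  also have "\<dots> = rf_frob_list A ps (S \<oslash> p) (rf_frob A p S a)"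
    using Cons.prems p
    by (intro Cons.IH[symmetric]) (auto simp: ds_quot_subset mem_ds_quot S frob_closed ac_simps simp flip: Cons.prems(5))
  finally show ?case
    by simp
qed simp

lemma frob_nat_hom:
  assumes "S \<preceq> T" "n \<in> S"
  shows "rf_frob_nat A n S \<in> homs u (rf_ring A S) (rf_ring A (S \<oslash> n))"
proof -
  have "n > 0"
    using assms ds_subset_stable divisor_stable_pos by blast
  then show ?thesis
    using frob_list_hom[OF assms(1) factor_list(1)[of n]] assms factor_list(2)[of n]
    by (simp add: rf_frob_nat_def[abs_def])
qed

lemma frob_nat_closed:
  assumes "S \<preceq> T" "n \<in> S" "a \<in> carrier (rf_ring A S)"
  shows "rf_frob_nat A n S a \<in> carrier (rf_ring A (S \<oslash> n))"
  using frob_nat_hom[OF assms(1,2)] assms(3) by (auto simp: homs_iff intro: rng_homD(1))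

lemma frob_nat_prime_times:
  assumes "S \<preceq> T" "prime p" "p * n \<in> S" "a \<in> carrier (rf_ring A S)"
  shows "rf_frob_nat A (p * n) S a = rf_frob_nat A n (S \<oslash> p) (rf_frob A p S a)"
    and "rf_frob_nat A (p * n) S a = rf_frob A p (S \<oslash> n) (rf_frob_nat A n S a)"
proof -
  let ?ps = "sorted_list_of_multiset (prime_factorization n)"
  have S: "divisor_stable S"
    using assms ds_subset_stable by blast
  have pn: "p * n > 0" "n > 0"
    using divisor_stable_pos[OF S assms(3)] by auto
  have "rf_frob_nat A (p * n) S a = rf_frob_list A (p # ?ps) S a"
    unfolding rf_frob_nat_def using factor_list[OF pn(1)] assms pn
    by (intro frob_list_perm) (auto simp: prime_factorization_prime_times)
  then show 1: "rf_frob_nat A (p * n) S a = rf_frob_nat A n (S \<oslash> p) (rf_frob A p S a)"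
    by (simp add: rf_frob_nat_def)
  show "rf_frob_nat A (p * n) S a = rf_frob A p (S \<oslash> n) (rf_frob_nat A n S a)"
    unfolding 1 using frob_list_frob[OF assms(1,2) factor_list(1)[OF pn(2)]] assms factor_list(2)[OF pn(2)]
    by (simp add: rf_frob_nat_def)
qed

lemma res_frob_list:
  assumes "S1 \<preceq> S2" "S2 \<preceq> T" "\<forall>q\<in>set ps. prime q" "prod_list ps \<in> S1"
    "a \<in> carrier (rf_ring A S2)"
  shows "rf_res A (S2 \<oslash> prod_list ps) (S1 \<oslash> prod_list ps) (rf_frob_list A ps S2 a) =
    rf_frob_list A ps S1 (rf_res A S2 S1 a)"
  using assms
proof (induction ps arbitrary: S1 S2 a)
  case (Cons p ps)
  have S: "divisor_stable S1" "divisor_stable S2" "S1 \<subseteq> S2"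
    using Cons.prems by (auto simp: ds_subset_def)
  have p: "prime p" "p \<in> S1"
    using divisor_stable_dvd[OF S(1) Cons.prems(4)] Cons.prems by auto
  with S have "p \<in> S2" by blast
  have "rf_res A (S2 \<oslash> p \<oslash> prod_list ps) (S1 \<oslash> p \<oslash> prod_list ps)
      (rf_frob_list A ps (S2 \<oslash> p) (rf_frob A p S2 a)) =
    rf_frob_list A ps (S1 \<oslash> p) (rf_res A (S2 \<oslash> p) (S1 \<oslash> p) (rf_frob A p S2 a))"
    using Cons.prems p \<open>p \<in> S2\<close>
    by (intro Cons.IH) (auto simp: ds_quot_subset ds_quot_mono mem_ds_quot S frob_closed ac_simps)
  then show ?case
    using res_frob[OF Cons.prems(1,2) p] Cons.prems by (simp add: ds_quot_quot S)
qed simp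

lemma res_frob_nat:
  assumes "S1 \<preceq> S2" "S2 \<preceq> T" "n \<in> S1" "a \<in> carrier (rf_ring A S2)"
  shows "rf_res A (S2 \<oslash> n) (S1 \<oslash> n) (rf_frob_nat A n S2 a) = rf_frob_nat A n S1 (rf_res A S2 S1 a)"
proof -
  have "n > 0"
    using assms ds_subset_stable divisor_stable_pos by blast
  then show ?thesis
    using res_frob_list[OF assms(1,2) factor_list(1)[of n]] assms factor_list(2)[of n]
    by (simp add: rf_frob_nat_def)
qed

end

section \<open>Dwork's lemma\<close>

context comm_rng begin

text \<open>From \<open>s * a + t * b = 1\<close> one gets \<open>z = s a z + t b z = a b (s y + t x)\<close>.\<close>

lemma coprime_divisible:
  fixes a b :: nat
  assumes "coprime a b" "x \<in> carrier R" "y \<in> carrier R" "z = add_pow R a x" "z = add_pow R b y"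
  shows "\<exists>w\<in>carrier R. z = add_pow R (a * b) w"
proof -
  obtain s t :: int where st: "s * int a + t * int b = 1"
    using bezout_int[of "int a" "int b"] \<open>coprime a b\<close> by auto
  have nat_int: "add_pow R k u = add_pow R (int k) u" for k :: nat and u
    by (simp add: add_pow_def int_pow_int)
  have z: "z \<in> carrier R"
    using assms by simp
  have "z = add_pow R (s * int a + t * int b) z"
    using z by (simp add: st)
  also have "\<dots> = add_pow R (s * int a) z \<oplus> add_pow R (t * int b) z"
    using z by (rule add.int_pow_mult)
  also have "add_pow R (s * int a) z = add_pow R (int (a * b)) (add_pow R s y)"
    using assms(3) by (simp add: assms(5) nat_int add.int_pow_pow ac_simps)
  also have "add_pow R (t * int b) z = add_pow R (int (a * b)) (add_pow R t x)"
    using assms(2) by (simp add: assms(4) nat_int add.int_pow_pow ac_simps)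
  also have "add_pow R (int (a * b)) (add_pow R s y) \<oplus> add_pow R (int (a * b)) (add_pow R t x) =
      add_pow R (int (a * b)) (add_pow R s y \<oplus> add_pow R t x)"
    using assms by (simp add: add.int_pow_distrib)
  finally show ?thesis
    using assms by (intro bexI[of _ "add_pow R s y \<oplus> add_pow R t x"]) (simp_all add: nat_int)
qed

lemma divisible_if_prime_power_divisible:
  fixes n :: nat
  assumes "n > 0" "z \<in> carrier R"
    and "\<And>p. prime p \<Longrightarrow> p dvd n \<Longrightarrow> \<exists>x\<in>carrier R. z = add_pow R (p ^ multiplicity p n) x"
  shows "\<exists>x\<in>carrier R. z = add_pow R n x"
proof (rule prime_power_parts_induct[OF \<open>n > 0\<close>])
  show "\<exists>x\<in>carrier R. z = add_pow R (1 :: nat) x"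
    using assms(2) by (intro bexI[of _ z]) simp_all
qed (use assms(3) coprime_divisible in blast)+

text \<open>The congruence \<open>ghost_sum_congruence\<close> for the generic elements \<open>X\<^sub>d ^ p + p Y\<^sub>d\<close> and \<open>X\<^sub>d\<close>, evaluated at
  \<open>X = y\<close> and \<open>Y = b\<close>. Working generically avoids a calculation with powers of differences in a
  ring without unit.\<close>

lemma ghost_sum_frobenius_congruence:
  fixes y b :: "nat \<Rightarrow> 'a"
  assumes "prime p" "m > 0"
    and D: "{d. d dvd m} \<subseteq> D" "D \<subseteq> {d. d dvd p * m}"
    and y: "\<And>d. d \<in> D \<Longrightarrow> y d \<in> carrier R"
    and b: "\<And>d. d dvd m \<Longrightarrow> b d \<in> carrier R"
  shows "\<exists>g\<in>carrier R.
    (\<Oplus>d\<in>{d. d dvd m}. add_pow R d (rng_pow R (rng_pow R (y d) p \<oplus> add_pow R p (b d)) (m div d))) =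
    (\<Oplus>d\<in>D. add_pow R d (rng_pow R (y d) (p * m div d))) \<oplus> add_pow R (p ^ multiplicity p (p * m)) g"
proof -
  define v where "v = case_sum (\<lambda>d. if d \<in> D then y d else \<zero>) (\<lambda>d. if d dvd m then b d else \<zero>)"
  have v: "v i \<in> carrier R" for i
    using y b by (cases i) (auto simp: v_def)
  have v_Inl: "v (Inl d) = y d" if "d \<in> D" for d
    using that by (simp add: v_def)
  have v_Inr: "v (Inr d) = b d" if "d dvd m" for d
    using that by (simp add: v_def)
  interpret wpoly_substitution R v
    by unfold_locales (rule v)
  have "p > 0" "p * m > 0"
    using assms prime_gt_0_nat by auto
  define X where "X = (\<lambda>d. wvar (Inl d))"
  define X' where "X' = (\<lambda>d. wvar (Inl d) ^ p + of_nat p * wvar (Inr d))"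
  have "of_nat (p ^ multiplicity p (p * m)) dvd
      (\<Sum>d | d dvd m. of_nat d * X' d ^ (m div d)) - (\<Sum>d\<in>D. of_nat d * X d ^ (p * m div d))"
    by (rule ghost_sum_congruence[OF assms(1-4)]) (simp add: X_def X'_def)
  then obtain g where "(\<Sum>d | d dvd m. of_nat d * X' d ^ (m div d)) -
      (\<Sum>d\<in>D. of_nat d * X d ^ (p * m div d)) = of_nat (p ^ multiplicity p (p * m)) * g"
    by (rule dvdE)
  then have "(\<Sum>d | d dvd m. of_nat d * X' d ^ (m div d)) =
      (\<Sum>d\<in>D. of_nat d * X d ^ (p * m div d)) + of_nat (p ^ multiplicity p (p * m)) * g"
    by (simp add: algebra_simps)
  then have "ev (\<Sum>d | d dvd m. of_nat d * X' d ^ (m div d)) =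
      ev (\<Sum>d\<in>D. of_nat d * X d ^ (p * m div d)) \<oplus> add_pow R (p ^ multiplicity p (p * m)) (ev g)"
    by (simp only: ev_add ev_of_nat_mult)
  moreover have "ev (\<Sum>d | d dvd m. of_nat d * X' d ^ (m div d)) =
    (\<Oplus>d\<in>{d. d dvd m}. add_pow R d (rng_pow R (rng_pow R (y d) p \<oplus> add_pow R p (b d)) (m div d)))"
    unfolding ev_sum
  proof (rule finsum_cong')
    show "ev (of_nat d * X' d ^ (m div d)) =
        add_pow R d (rng_pow R (rng_pow R (y d) p \<oplus> add_pow R p (b d)) (m div d))"
      if "d \<in> {d. d dvd m}" for d
    proof -
      have "const (X' d) = 0"
        using \<open>p > 0\<close> by (simp add: X'_def const_add const_power const_mult const_wvar)
      moreover have "ev (X' d) = rng_pow R (y d) p \<oplus> add_pow R p (b d)"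
        using \<open>p > 0\<close> that D
        by (auto simp: X'_def ev_add ev_of_nat_mult ev_power const_wvar ev_wvar v_Inl v_Inr)
      ultimately show ?thesis
        using that div_divisor_pos[OF \<open>m > 0\<close>] by (simp add: ev_of_nat_mult ev_power)
    qed
  qed (use y b D \<open>p > 0\<close> div_divisor_pos[OF \<open>m > 0\<close>] in \<open>auto simp: rng_pow_closed\<close>)
  moreover have "ev (\<Sum>d\<in>D. of_nat d * X d ^ (p * m div d)) =
    (\<Oplus>d\<in>D. add_pow R d (rng_pow R (y d) (p * m div d)))"
    unfolding ev_sum
  proof (rule finsum_cong')
    show "ev (of_nat d * X d ^ (p * m div d)) = add_pow R d (rng_pow R (y d) (p * m div d))"
      if "d \<in> D" for d
      using that D(2) div_divisor_pos[OF \<open>p * m > 0\<close>, of d]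
      by (auto simp: X_def ev_of_nat_mult ev_power const_wvar ev_wvar v_Inl)
  qed (use y D div_divisor_pos[OF \<open>p * m > 0\<close>] in \<open>auto simp: rng_pow_closed\<close>)
  ultimately show ?thesis
    using ev_closed by auto
qed

end

context rf_object begin

text \<open>Dwork's lemma in an object of \<open>RF\<^sub>T\<close>. The classical lemma concerns a ring with lifts of Frobenius
  as endomorphisms. Here \<open>F\<^sub>p\<close> leads to another ring, and the remedy is to look for the coordinate \<open>x n\<close> in the ring at
  \<open>S \<oslash> n\<close>: to the image of \<open>x d\<close> at \<open>S \<oslash> m\<close>, where \<open>d\<close> divides \<open>m\<close>, one can still apply
  \<open>F\<^sub>p\<close> whenever \<open>p * m \<in> S\<close>, and the result lies where the equation for \<open>p * m\<close> has to be solved.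

  The \<open>x n\<close> are found by recursion on \<open>n\<close>. One has to divide the difference of \<open>w n\<close> and the terms
  with \<open>d < n\<close> by \<open>n\<close>, and by \<open>divisible_if_prime_power_divisible\<close> it suffices to divide it by
  \<open>p ^ multiplicity p n\<close> for every prime \<open>p\<close> in \<open>n = p * m\<close>. Apply \<open>F\<^sub>p\<close> to the equation for \<open>w m\<close>.
  On the left this gives \<open>w n\<close> modulo that prime power, and on the right
  \<open>ghost_sum_frobenius_congruence\<close> compares the sum with the terms for \<open>n\<close>.\<close>

theorem dwork:
  assumes S: "S \<preceq> T"
    and w_closed: "\<And>n. n \<in> S \<Longrightarrow> w n \<in> carrier (rf_ring A (S \<oslash> n))"
    and w_cong: "\<And>p n. prime p \<Longrightarrow> p * n \<in> S \<Longrightarrow> \<exists>b\<in>carrier (rf_ring A (S \<oslash> (p * n))).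
      w (p * n) = rf_frob A p (S \<oslash> n) (w n) \<oplus>\<^bsub>rf_ring A (S \<oslash> (p * n))\<^esub>
        add_pow (rf_ring A (S \<oslash> (p * n))) (p ^ multiplicity p (p * n)) b"
  shows "\<exists>x. \<forall>n\<in>S. x n \<in> carrier (rf_ring A (S \<oslash> n)) \<and>
    w n = (\<Oplus>\<^bsub>rf_ring A (S \<oslash> n)\<^esub>d\<in>{d. d dvd n}. add_pow (rf_ring A (S \<oslash> n)) d
      (rng_pow (rf_ring A (S \<oslash> n)) (rf_res A (S \<oslash> d) (S \<oslash> n) (x d)) (n div d)))"
proof -
  define M where "M n = rf_ring A (S \<oslash> n)" for n
  define r where "r n d = rf_res A (S \<oslash> d) (S \<oslash> n)" for n d
  have stable: "divisor_stable S"
    using S by (rule ds_subset_stable)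
  have subset: "S \<oslash> n \<preceq> T" if "n \<in> S" for n
    using S that by (rule ds_quot_subset)
  have M: "comm_rng (M n)" if "n \<in> S" for n
    unfolding M_def using subset[OF that] by (rule rng)
  have r_hom: "r n d \<in> rng_hom (M d) (M n)" if "n \<in> S" "d dvd n" for n d
    unfolding r_def M_def
    using that divisor_stable_dvd[OF stable] by (intro res_rng_hom ds_quot_antimono stable subset)
  define G where "G x n D = (\<Oplus>\<^bsub>M n\<^esub>d\<in>D. add_pow (M n) d (rng_pow (M n) (r n d (x d)) (n div d)))" for x n D
  have G_full: "G x m {d. d dvd m} = G x m {d. d dvd m \<and> d < m} \<oplus>\<^bsub>M m\<^esub> add_pow (M m) m (x m)"
    if "m \<in> S" "\<And>d. d dvd m \<Longrightarrow> x d \<in> carrier (M d)" for x m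
  proof -
    interpret M: comm_rng "M m"
      using \<open>m \<in> S\<close> by (rule M)
    have "m > 0"
      using stable \<open>m \<in> S\<close> by (rule divisor_stable_pos)
    have t: "add_pow (M m) d (rng_pow (M m) (r m d (x d)) (m div d)) \<in> carrier (M m)" if "d dvd m" for d
      using that \<open>m > 0\<close> \<open>m \<in> S\<close> \<open>\<And>d. d dvd m \<Longrightarrow> x d \<in> carrier (M d)\<close>
      by (intro M.add.nat_pow_closed M.rng_pow_closed div_divisor_pos rng_homD(1)[OF r_hom]) auto
    have "r m m (x m) = x m"
      using that subset[OF \<open>m \<in> S\<close>] by (auto simp: r_def M_def intro: res_id)
    then show ?thesis
      unfolding G_def sum_divisors_split[OF \<open>m > 0\<close>] using t \<open>m > 0\<close> t[of m]
      by (subst M.finsum_insert) (auto simp: M.a_comm)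
  qed
  have G_restrict: "G (restrict x {..<n}) n {d. d dvd n \<and> d < n} = G x n {d. d dvd n \<and> d < n}"
    if "n \<in> S" "\<And>d. d dvd n \<Longrightarrow> d < n \<Longrightarrow> x d \<in> carrier (M d)" for x n
  proof -
    interpret M: comm_rng "M n"
      using \<open>n \<in> S\<close> by (rule M)
    show ?thesis
      unfolding G_def using that divisor_stable_pos[OF stable \<open>n \<in> S\<close>]
      by (intro M.finsum_cong' Pi_I M.add.nat_pow_closed M.rng_pow_closed div_divisor_pos
          rng_homD(1)[OF r_hom]) auto
  qed
  \<comment> \<open>The restriction to \<open>{..<n}\<close> makes the condition at \<open>n\<close> depend on earlier values only, also where
    these are not in the carrier, as \<open>dependent_wellorder_choice\<close> requires.\<close>
  have "\<exists>x. \<forall>n. n \<in> S \<longrightarrow> x n \<in> carrier (M n) \<and>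
      w n = G (restrict x {..<n}) n {d. d dvd n \<and> d < n} \<oplus>\<^bsub>M n\<^esub> add_pow (M n) n (x n)"
  proof (rule dependent_wellorder_choice)
    fix a and f g :: "nat \<Rightarrow> 'a" and n
    assume "\<And>d. d < n \<Longrightarrow> f d = g d"
    then have "restrict f {..<n} = restrict g {..<n}"
      by auto
    then show "(n \<in> S \<longrightarrow> a \<in> carrier (M n) \<and>
          w n = G (restrict f {..<n}) n {d. d dvd n \<and> d < n} \<oplus>\<^bsub>M n\<^esub> add_pow (M n) n a) =
        (n \<in> S \<longrightarrow> a \<in> carrier (M n) \<and>
          w n = G (restrict g {..<n}) n {d. d dvd n \<and> d < n} \<oplus>\<^bsub>M n\<^esub> add_pow (M n) n a)"
      by simp
  next
    fix n x
    assume IH: "\<And>d. d < n \<Longrightarrow> d \<in> S \<longrightarrow> x d \<in> carrier (M d) \<and>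
      w d = G (restrict x {..<d}) d {e. e dvd d \<and> e < d} \<oplus>\<^bsub>M d\<^esub> add_pow (M d) d (x d)"
    have "\<exists>a. a \<in> carrier (M n) \<and> w n = G (restrict x {..<n}) n {d. d dvd n \<and> d < n} \<oplus>\<^bsub>M n\<^esub> add_pow (M n) n a"
      if "n \<in> S"
    proof -
      let ?D = "{d. d dvd n \<and> d < n}"
      interpret M: comm_rng "M n"
        using \<open>n \<in> S\<close> by (rule M)
      have "n > 0"
        using stable \<open>n \<in> S\<close> by (rule divisor_stable_pos)
      have x: "x d \<in> carrier (M d)" if "d dvd n" "d < n" for d
        using that IH divisor_stable_dvd[OF stable \<open>n \<in> S\<close>] by blast
      have w_G: "w m = G x m {d. d dvd m}" if "m dvd n" "m < n" for m
      proof -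
        have "m \<in> S"
          using that divisor_stable_dvd[OF stable \<open>n \<in> S\<close>] by blast
        have xm: "x d \<in> carrier (M d)" if "d dvd m" for d
        proof (rule x)
          show "d dvd n"
            using \<open>d dvd m\<close> \<open>m dvd n\<close> by (rule dvd_trans)
          have "m > 0"
            using \<open>m dvd n\<close> \<open>n > 0\<close> by (rule dvd_pos_nat[rotated])
          then show "d < n"
            using dvd_imp_le[OF \<open>d dvd m\<close>] \<open>m < n\<close> by simp
        qed
        show ?thesis
          using IH[OF \<open>m < n\<close>] \<open>m \<in> S\<close> G_full[OF \<open>m \<in> S\<close> xm] G_restrict[OF \<open>m \<in> S\<close> xm]
          by simp
      qed
      have y: "r n d (x d) \<in> carrier (M n)" if "d \<in> ?D" for d
        using that \<open>n \<in> S\<close> x by (intro rng_homD(1)[OF r_hom]) auto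
      have G_closed: "G x n ?D \<in> carrier (M n)"
        unfolding G_def using y \<open>n > 0\<close>
        by (intro M.finsum_closed Pi_I M.add.nat_pow_closed M.rng_pow_closed div_divisor_pos) auto
      have wn: "w n \<in> carrier (M n)"
        unfolding M_def using \<open>n \<in> S\<close> by (rule w_closed)
      \<comment> \<open>The heart of the proof: divisibility by each prime power in \<open>n\<close>.\<close>
      have "\<exists>g\<in>carrier (M n). w n \<ominus>\<^bsub>M n\<^esub> G x n ?D = add_pow (M n) (p ^ multiplicity p n) g"
        if p: "prime p" "p dvd n" for p
      proof -
        obtain m where n: "n = p * m"
          using \<open>p dvd n\<close> ..
        have m: "m dvd n" "m < n" "m > 0" "m \<in> S"
          using n \<open>n > 0\<close> prime_gt_1_nat[OF p(1)] divisor_stable_dvd[OF stable \<open>n \<in> S\<close>] by auto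
        have "p \<in> S \<oslash> m"
          using \<open>n \<in> S\<close> by (simp add: n mem_ds_quot stable)
        have quot: "S \<oslash> m \<oslash> p = S \<oslash> n"
          by (simp add: ds_quot_quot stable n mult.commute)
        interpret F: comm_rng_hom "M m" "M n" "rf_frob A p (S \<oslash> m)"
          using frob_rng_hom[OF subset[OF m(4)] p(1) \<open>p \<in> S \<oslash> m\<close>]
          by (intro comm_rng_hom.intro comm_rng_hom_axioms.intro M m \<open>n \<in> S\<close>) (simp add: M_def quot)
        have "d < n" if "d dvd m" for d
          using dvd_imp_le[OF that m(3)] m(2) by simp
        then have D: "{d. d dvd m} \<subseteq> ?D" "?D \<subseteq> {d. d dvd p * m}"
          by (auto simp: n)
        \<comment> \<open>The congruence \<open>frob_cong\<close> for the image of \<open>x d\<close> in the ring at \<open>S \<oslash> m\<close>.\<close>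
        obtain e where e: "e d \<in> carrier (M n)"
            "rf_frob A p (S \<oslash> m) (r m d (x d)) = rng_pow (M n) (r n d (x d)) p \<oplus>\<^bsub>M n\<^esub> add_pow (M n) p (e d)"
          if "d dvd m" for d
        proof -
          have "\<exists>b\<in>carrier (M n). rf_frob A p (S \<oslash> m) (r m d (x d)) =
              rng_pow (M n) (r n d (x d)) p \<oplus>\<^bsub>M n\<^esub> add_pow (M n) p b" if "d dvd m" for d
          proof -
            have d: "d \<in> S" "d \<in> ?D"
              using that D(1) divisor_stable_dvd[OF stable m(4)] by auto
            have "r m d (x d) \<in> carrier (M m)"
              using that d x by (intro rng_homD(1)[OF r_hom] m) auto
            moreover have "rf_res A (S \<oslash> m) (S \<oslash> n) (r m d (x d)) = r n d (x d)"
              unfolding r_def using that d x m \<open>n \<in> S\<close>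
              by (intro res_res ds_quot_antimono stable subset) (auto simp: M_def)
            ultimately show ?thesis
              using frob_cong[OF subset[OF m(4)] p(1) \<open>p \<in> S \<oslash> m\<close>, of "r m d (x d)"]
              by (simp add: quot M_def)
          qed
          then show ?thesis
            using that by metis
        qed
        have rm: "r m d (x d) \<in> carrier (M m)" if "d dvd m" for d
          using that D x by (intro rng_homD(1)[OF r_hom] m) auto
        have "rf_frob A p (S \<oslash> m) (w m) =
            (\<Oplus>\<^bsub>M n\<^esub>d\<in>{d. d dvd m}. rf_frob A p (S \<oslash> m) (add_pow (M m) d (rng_pow (M m) (r m d (x d)) (m div d))))"
          unfolding w_G[OF m(1,2)] G_def using rm m(3)
          by (intro F.finsum F.dom.add.nat_pow_closed F.dom.rng_pow_closed div_divisor_pos) auto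
        also have "\<dots> = (\<Oplus>\<^bsub>M n\<^esub>d\<in>{d. d dvd m}. add_pow (M n) d
            (rng_pow (M n) (rng_pow (M n) (r n d (x d)) p \<oplus>\<^bsub>M n\<^esub> add_pow (M n) p (e d)) (m div d)))"
        proof (rule M.finsum_cong')
          fix d assume "d \<in> {d. d dvd m}"
          then show "rf_frob A p (S \<oslash> m) (add_pow (M m) d (rng_pow (M m) (r m d (x d)) (m div d))) =
              add_pow (M n) d (rng_pow (M n)
                (rng_pow (M n) (r n d (x d)) p \<oplus>\<^bsub>M n\<^esub> add_pow (M n) p (e d)) (m div d))"
            using rm m(3) div_divisor_pos[OF m(3), of d] e(2)[of d]
            by (simp add: F.add_pow F.rng_pow F.dom.rng_pow_closed)
        next
          show "(\<lambda>d. add_pow (M n) d (rng_pow (M n)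
                (rng_pow (M n) (r n d (x d)) p \<oplus>\<^bsub>M n\<^esub> add_pow (M n) p (e d)) (m div d)))
              \<in> {d. d dvd m} \<rightarrow> carrier (M n)"
            using y e(1) D(1) p(1) m(3) prime_gt_0_nat[OF p(1)]
            by (intro Pi_I M.add.nat_pow_closed M.rng_pow_closed div_divisor_pos M.a_closed) auto
        qed simp
        finally obtain g where g: "g \<in> carrier (M n)"
          "rf_frob A p (S \<oslash> m) (w m) = G x n ?D \<oplus>\<^bsub>M n\<^esub> add_pow (M n) (p ^ multiplicity p n) g"
          using M.ghost_sum_frobenius_congruence[where y = "\<lambda>d. r n d (x d)" and b = e, OF p(1) m(3) D y e(1)] by (auto simp: G_def n)
        obtain b where b: "b \<in> carrier (M n)"
          "w n = rf_frob A p (S \<oslash> m) (w m) \<oplus>\<^bsub>M n\<^esub> add_pow (M n) (p ^ multiplicity p n) b"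
          using w_cong[OF p(1), of m] \<open>n \<in> S\<close> by (auto simp: n M_def)
        show ?thesis
          using g b G_closed
          by (intro bexI[of _ "g \<oplus>\<^bsub>M n\<^esub> b"])
             (simp_all add: M.add.nat_pow_distrib M.minus_eq M.a_ac M.r_neg M.r_neg1 M.r_neg2)
      qed
      then obtain a where a: "a \<in> carrier (M n)" "w n \<ominus>\<^bsub>M n\<^esub> G x n ?D = add_pow (M n) n a"
        using M.divisible_if_prime_power_divisible[OF \<open>n > 0\<close>, of "w n \<ominus>\<^bsub>M n\<^esub> G x n ?D"] wn G_closed by auto
      have "w n = G x n ?D \<oplus>\<^bsub>M n\<^esub> (w n \<ominus>\<^bsub>M n\<^esub> G x n ?D)"
        using wn G_closed by (simp add: M.minus_eq M.a_lcomm M.r_neg)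
      then have "w n = G x n ?D \<oplus>\<^bsub>M n\<^esub> add_pow (M n) n a"
        unfolding a(2) .
      then have "w n = G (restrict x {..<n}) n ?D \<oplus>\<^bsub>M n\<^esub> add_pow (M n) n a"
        by (subst G_restrict[OF that x])
      with a(1) show ?thesis
        by (intro exI conjI)
    qed
    then show "\<exists>a. n \<in> S \<longrightarrow> a \<in> carrier (M n) \<and>
      w n = G (restrict x {..<n}) n {d. d dvd n \<and> d < n} \<oplus>\<^bsub>M n\<^esub> add_pow (M n) n a"
      by blast
  qed
  then obtain x where x: "x n \<in> carrier (M n)"
      "w n = G (restrict x {..<n}) n {d. d dvd n \<and> d < n} \<oplus>\<^bsub>M n\<^esub> add_pow (M n) n (x n)"
    if "n \<in> S" for n
    by blast
  have "w n = G x n {d. d dvd n \<and> d < n} \<oplus>\<^bsub>M n\<^esub> add_pow (M n) n (x n)" if "n \<in> S" for n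
    using x(2)[OF that] G_restrict[OF that] x(1) divisor_stable_dvd[OF stable that] by simp
  then have "w n = G x n {d. d dvd n}" if "n \<in> S" for n
    using that x(1) divisor_stable_dvd[OF stable that] by (subst G_full) auto
  with x(1) show ?thesis
    unfolding G_def M_def r_def by blast
qed

end

section \<open>Integrality of the universal Witt polynomials\<close>

text \<open>The ring of a type class as a record, so that results about records apply to the polynomial ring.\<close>

definition class_ring :: "'a::comm_ring_1 ring" where
  "class_ring = \<lparr>carrier = UNIV, monoid.mult = (*), monoid.one = 1, ring.zero = 0, ring.add = (+)\<rparr>"

lemma class_ring_simps [simp]:
  "carrier class_ring = UNIV" "monoid.mult class_ring = (*)" "monoid.one class_ring = 1"
  "ring.zero class_ring = 0" "ring.add class_ring = (+)"
  by (simp_all add: class_ring_def)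

lemma cring_class_ring: "cring class_ring"
proof (rule cringI)
  show "abelian_group class_ring"
    by (rule abelian_groupI) (auto simp: algebra_simps intro: exI[of _ "- _"])
  show "comm_monoid class_ring"
    by (rule comm_monoidI) (auto simp: algebra_simps)
qed (auto simp: algebra_simps)

interpretation class_ring: cring class_ring
  by (rule cring_class_ring)

lemma class_ring_add_pow: "add_pow class_ring (k :: nat) x = of_nat k * x"
  by (induction k) (auto simp: algebra_simps)

lemma class_ring_rng_pow: "k > 0 \<Longrightarrow> rng_pow class_ring x k = x ^ k"
  by (induction k rule: nat_induct_non_zero) (auto simp: rng_pow_Suc)

lemma class_ring_finsum: "finsum class_ring f K = sum f K"
  by (induction K rule: infinite_finite_induct) auto

text \<open>The lift of Frobenius to integer polynomials that sends
  each variable to its \<open>p\<close>-th power.\<close>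

definition frob_poly :: "nat \<Rightarrow> witt_poly \<Rightarrow> witt_poly" where
  "frob_poly p = wpoly_eval class_ring (\<lambda>i. wvar i ^ p)"

lemma frob_poly_wvar: "frob_poly p (wvar i) = wvar i ^ p"
  by (simp add: frob_poly_def class_ring.wpoly_eval_wvar)

lemma frob_poly_one: "frob_poly p 1 = 1"
  by (simp add: frob_poly_def class_ring.wpoly_eval_one)

lemma frob_poly_zero: "frob_poly p 0 = 0"
  by (simp add: frob_poly_def class_ring.wpoly_eval_zero)

lemma frob_poly_add: "frob_poly p (f + g) = frob_poly p f + frob_poly p g"
  by (simp add: frob_poly_def class_ring.wpoly_eval_add)

lemma frob_poly_mult: "frob_poly p (f * g) = frob_poly p f * frob_poly p g"
  by (simp add: frob_poly_def class_ring.wpoly_eval_mult)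

lemma frob_poly_diff: "frob_poly p (f - g) = frob_poly p f - frob_poly p g"
  using frob_poly_add[of p "f - g" g] by simp

lemma frob_poly_minus: "frob_poly p (- f) = - frob_poly p f"
  using frob_poly_diff[of p 0 f] by (simp add: frob_poly_zero)

lemma frob_poly_of_nat: "frob_poly p (of_nat k) = of_nat k"
  by (induction k) (auto simp: frob_poly_zero frob_poly_one frob_poly_add)

lemma frob_poly_power: "frob_poly p (f ^ k) = frob_poly p f ^ k"
  by (induction k) (auto simp: frob_poly_one frob_poly_mult)

lemma frob_poly_sum: "frob_poly p (sum f K) = (\<Sum>k\<in>K. frob_poly p (f k))"
  by (induction K rule: infinite_finite_induct) (auto simp: frob_poly_zero frob_poly_add)

lemma frob_poly_commute: "frob_poly p (frob_poly q f) = frob_poly q (frob_poly p f)"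
  by (induction f rule: witt_poly_induct)
     (auto simp: frob_poly_one frob_poly_wvar frob_poly_power frob_poly_diff frob_poly_mult
       simp flip: power_mult simp: mult.commute)

lemma frob_poly_cong:
  assumes "prime p"
  shows "of_nat p dvd frob_poly p f - f ^ p"
proof (induction f rule: witt_poly_induct)
  case (diff f g)
  have "of_nat p dvd ((f - g) + g) ^ p - ((f - g) ^ p + g ^ p)"
    by (rule freshmans_dream_mod[OF assms])
  then have "of_nat p dvd f ^ p - ((f - g) ^ p + g ^ p)"
    by simp
  from dvd_add[OF this dvd_diff[OF diff]]
  show ?case
    by (simp add: frob_poly_diff algebra_simps)
next
  case (mult f g)
  have "of_nat p dvd frob_poly p f * (frob_poly p g - g ^ p) + (frob_poly p f - f ^ p) * g ^ p"
    using mult by (intro dvd_add) auto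
  then show ?case
    by (simp add: frob_poly_mult power_mult_distrib algebra_simps)
qed (auto simp: frob_poly_one frob_poly_wvar)

text \<open>The polynomial ring, placed at every \<open>S\<close>, with the commuting Frobenius lifts \<open>frob_poly p\<close>. As it
  is an object of \<open>RF\<^sub>T\<close>, the lemma \<open>dwork\<close> also yields the integrality of the universal Witt
  polynomials.\<close>

definition poly_system :: "witt_poly rf_system" where
  "poly_system = \<lparr>rf_ring = (\<lambda>_. class_ring), rf_res = (\<lambda>_ _ f. f), rf_frob = (\<lambda>p _. frob_poly p)\<rparr>"

lemma rf_object_poly_system: "rf_object True {0<..} poly_system"
proof
  fix S and p :: nat and a :: witt_poly
  assume "prime p"
  obtain g where "frob_poly p a - a ^ p = of_nat p * g"
    using frob_poly_cong[OF \<open>prime p\<close>] by (rule dvdE)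
  then have "frob_poly p a = a ^ p + of_nat p * g"
    by (simp add: algebra_simps)
  then show "\<exists>b\<in>carrier (rf_ring poly_system (S \<oslash> p)). rf_frob poly_system p S a =
      rng_pow (rf_ring poly_system (S \<oslash> p)) (rf_res poly_system S (S \<oslash> p) a) p
        \<oplus>\<^bsub>rf_ring poly_system (S \<oslash> p)\<^esub> add_pow (rf_ring poly_system (S \<oslash> p)) p b"
    using \<open>prime p\<close> by (auto simp: poly_system_def class_ring_add_pow class_ring_rng_pow prime_gt_0_nat)
qed (auto simp: poly_system_def is_ring_def cring_class_ring homs_def ring_hom_def
    frob_poly_add frob_poly_mult frob_poly_one frob_poly_commute)

text \<open>The hypothesis of \<open>dwork\<close> for the system \<open>poly_system\<close>. It amounts to the condition that the
  \<open>w n\<close> are the ghost components of a family of polynomials.\<close>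

definition dwork_congruent :: "(nat \<Rightarrow> witt_poly) \<Rightarrow> bool" where
  "dwork_congruent w \<longleftrightarrow> (\<forall>p n. prime p \<longrightarrow> n > 0 \<longrightarrow>
     of_nat (p ^ multiplicity p (p * n)) dvd w (p * n) - frob_poly p (w n))"

lemma dwork_congruentD:
  "dwork_congruent w \<Longrightarrow> prime p \<Longrightarrow> n > 0 \<Longrightarrow>
    of_nat (p ^ multiplicity p (p * n)) dvd w (p * n) - frob_poly p (w n)"
  by (simp add: dwork_congruent_def)

lemma ghost_poly_surj:
  assumes "dwork_congruent w"
  shows "\<exists>c. \<forall>n>0. ghost_poly c n = w n"
proof -
  interpret rf_object True "{0<..}" poly_system
    by (rule rf_object_poly_system)
  have "divisor_stable {0<..}"
    by (auto simp: divisor_stable_def dvd_pos_nat)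
  then have S: "{0<..} \<preceq> {0<..}"
    by (simp add: ds_subset_def)
  have "\<exists>x. \<forall>n\<in>{0<..}. x n \<in> carrier (rf_ring poly_system ({0<..} \<oslash> n)) \<and>
    w n = (\<Oplus>\<^bsub>rf_ring poly_system ({0<..} \<oslash> n)\<^esub>d\<in>{d. d dvd n}.
      add_pow (rf_ring poly_system ({0<..} \<oslash> n)) d
      (rng_pow (rf_ring poly_system ({0<..} \<oslash> n))
        (rf_res poly_system ({0<..} \<oslash> d) ({0<..} \<oslash> n) (x d)) (n div d)))"
  proof (rule dwork[OF S])
    fix p n :: nat
    assume "prime p" "p * n \<in> {0<..}"
    then have "of_nat (p ^ multiplicity p (p * n)) dvd w (p * n) - frob_poly p (w n)"
      using assms by (intro dwork_congruentD) auto
    then obtain b where "w (p * n) - frob_poly p (w n) = of_nat (p ^ multiplicity p (p * n)) * b"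
      by (rule dvdE)
    then have "w (p * n) = frob_poly p (w n) + of_nat (p ^ multiplicity p (p * n)) * b"
      by (simp add: algebra_simps)
    then show "\<exists>b\<in>carrier (rf_ring poly_system ({0<..} \<oslash> (p * n))).
      w (p * n) = rf_frob poly_system p ({0<..} \<oslash> n) (w n) \<oplus>\<^bsub>rf_ring poly_system ({0<..} \<oslash> (p * n))\<^esub>
        add_pow (rf_ring poly_system ({0<..} \<oslash> (p * n))) (p ^ multiplicity p (p * n)) b"
      by (auto simp: poly_system_def class_ring_add_pow)
  qed (simp add: poly_system_def)
  then obtain x where "w n = (\<Sum>d | d dvd n. of_nat d * rng_pow class_ring (x d) (n div d))" if "n > 0" for n
    by (auto simp: poly_system_def class_ring_add_pow class_ring_finsum)
  then have "ghost_poly x n = w n" if "n > 0" for n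
    using that by (simp add: ghost_poly_def class_ring_rng_pow div_divisor_pos)
  then show ?thesis
    by blast
qed

lemma of_nat_mult_cancel:
  fixes f g :: witt_poly
  assumes "of_nat n * f = of_nat n * g" "n > 0"
  shows "f = g"
proof (rule poly_mapping_eqI)
  fix m
  have "Poly_Mapping.lookup (of_nat k * h) m = int k * Poly_Mapping.lookup h m" for k and h :: witt_poly
    by (induction k) (auto simp: lookup_add algebra_simps)
  with assms show "Poly_Mapping.lookup f m = Poly_Mapping.lookup g m"
    by (metis mult_cancel_left of_nat_0_eq_iff less_numeral_extra(3))
qed

text \<open>The polynomial ring is torsion free, so the coordinates can be recovered from the ghost
  components one after the other.\<close>

lemma ghost_poly_inj:
  assumes "\<And>n. n > 0 \<Longrightarrow> ghost_poly c n = ghost_poly c' n" "n > 0"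
  shows "c n = c' n"
  using \<open>n > 0\<close>
proof (induction n rule: less_induct)
  case (less n)
  let ?s = "\<lambda>c. \<Sum>d | d dvd n \<and> d < n. of_nat d * c d ^ (n div d) :: witt_poly"
  have split: "ghost_poly c n = of_nat n * c n + ?s c" for c
    unfolding ghost_poly_def sum_divisors_split[OF less.prems]
    by (subst sum.insert) (use less.prems in auto)
  have "?s c = ?s c'"
  proof (rule sum.cong)
    fix d assume "d \<in> {d. d dvd n \<and> d < n}"
    then have "d < n" "d > 0"
      using less.prems by (auto intro: dvd_pos_nat)
    then have "c d = c' d"
      by (rule less.IH)
    then show "of_nat d * c d ^ (n div d) = of_nat d * c' d ^ (n div d)"
      by simp
  qed simp
  then have "of_nat n * c n = of_nat n * c' n"
    using assms(1)[OF less.prems] by (simp add: split)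
  then show ?case
    using less.prems by (rule of_nat_mult_cancel)
qed

text \<open>Existence and uniqueness together justify the definite description in \<open>witt_coords\<close>. The
  value at \<open>0\<close> has to be normalized since no ghost component with \<open>n \<ge> 1\<close> involves it.\<close>

lemma ghost_poly_witt_coords:
  assumes "dwork_congruent w" "n > 0"
  shows "ghost_poly (witt_coords w) n = w n"
proof -
  obtain c where c: "\<And>n. n > 0 \<Longrightarrow> ghost_poly c n = w n"
    using ghost_poly_surj[OF assms(1)] by blast
  \<comment> \<open>A divisor of \<open>n > 0\<close> is never \<open>0\<close>.\<close>
  have upd: "ghost_poly (c(0 := 0)) n = ghost_poly c n" if "n > 0" for n
    unfolding ghost_poly_def by (rule sum.cong) (use that in auto)
  have "\<exists>!c. c 0 = 0 \<and> (\<forall>n\<ge>1. ghost_poly c n = w n)"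
  proof (rule ex1I[of _ "c(0 := 0)"])
    fix c' assume c': "c' 0 = 0 \<and> (\<forall>n\<ge>1. ghost_poly c' n = w n)"
    show "c' = c(0 := 0)"
    proof
      fix n
      have "ghost_poly c' k = ghost_poly (c(0 := 0)) k" if "k > 0" for k
        unfolding upd[OF that] c[OF that] using c' that by simp
      then show "c' n = (c(0 := 0)) n"
        using c' by (cases "n = 0") (simp, blast intro: ghost_poly_inj)
    qed
  next
    show "(c(0 := 0)) 0 = 0 \<and> (\<forall>n\<ge>1. ghost_poly (c(0 := 0)) n = w n)"
      using upd c by simp
  qed
  from theI'[OF this] show ?thesis
    using \<open>n > 0\<close> by (simp add: witt_coords_def)
qed

lemma dwork_congruent_add:
  assumes "dwork_congruent w" "dwork_congruent w'"
  shows "dwork_congruent (\<lambda>n. w n + w' n)"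
  unfolding dwork_congruent_def
proof (intro allI impI)
  fix p n :: nat assume "prime p" "n > 0"
  then have "of_nat (p ^ multiplicity p (p * n)) dvd
      (w (p * n) - frob_poly p (w n)) + (w' (p * n) - frob_poly p (w' n))"
    using assms by (intro dvd_add dwork_congruentD)
  also have "\<dots> = w (p * n) + w' (p * n) - frob_poly p (w n + w' n)"
    by (simp add: frob_poly_add)
  finally show "of_nat (p ^ multiplicity p (p * n)) dvd
      w (p * n) + w' (p * n) - frob_poly p (w n + w' n)" .
qed

lemma dwork_congruent_mult:
  assumes "dwork_congruent w" "dwork_congruent w'"
  shows "dwork_congruent (\<lambda>n. w n * w' n)"
  unfolding dwork_congruent_def
proof (intro allI impI)
  fix p n :: nat assume "prime p" "n > 0"
  then have "of_nat (p ^ multiplicity p (p * n)) dvd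
      w (p * n) * (w' (p * n) - frob_poly p (w' n)) + (w (p * n) - frob_poly p (w n)) * frob_poly p (w' n)"
    using assms by (intro dvd_add dvd_mult dvd_mult2 dwork_congruentD)
  also have "\<dots> = w (p * n) * w' (p * n) - frob_poly p (w n * w' n)"
    by (simp add: frob_poly_mult algebra_simps)
  finally show "of_nat (p ^ multiplicity p (p * n)) dvd
      w (p * n) * w' (p * n) - frob_poly p (w n * w' n)" .
qed

lemma dwork_congruent_uminus:
  assumes "dwork_congruent w"
  shows "dwork_congruent (\<lambda>n. - w n)"
  unfolding dwork_congruent_def
proof (intro allI impI)
  fix p n :: nat assume "prime p" "n > 0"
  then have "of_nat (p ^ multiplicity p (p * n)) dvd - (w (p * n) - frob_poly p (w n))"
    using assms by (simp only: dvd_minus_iff dwork_congruentD)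
  then show "of_nat (p ^ multiplicity p (p * n)) dvd - w (p * n) - frob_poly p (- w n)"
    by (simp add: frob_poly_minus)
qed

lemma dwork_congruent_shift:
  assumes "dwork_congruent w" "k > 0"
  shows "dwork_congruent (\<lambda>n. w (k * n))"
  unfolding dwork_congruent_def
proof (intro allI impI)
  fix p n :: nat assume "prime p" "n > 0"
  then have "multiplicity p (p * n) \<le> multiplicity p (p * (k * n))"
    using \<open>k > 0\<close> by (intro dvd_imp_multiplicity_le) (auto simp: prime_gt_0_nat)
  then have "(of_nat (p ^ multiplicity p (p * n)) :: witt_poly) dvd of_nat (p ^ multiplicity p (p * (k * n)))"
    unfolding of_nat_power by (rule le_imp_power_dvd)
  also have "\<dots> dvd w (p * (k * n)) - frob_poly p (w (k * n))"
    using assms \<open>prime p\<close> \<open>n > 0\<close> by (intro dwork_congruentD) auto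
  finally show "of_nat (p ^ multiplicity p (p * n)) dvd w (k * (p * n)) - frob_poly p (w (k * n))"
    by (simp add: mult.left_commute)
qed

lemma dwork_congruent_ghost_wvar: "dwork_congruent (ghost_poly (\<lambda>d. wvar (h d)))"
  unfolding dwork_congruent_def
proof (intro allI impI)
  fix p n :: nat assume p: "prime p" "n > 0"
  have "of_nat (p ^ multiplicity p (p * n)) dvd
      (\<Sum>d | d dvd n. of_nat d * (wvar (h d) ^ p) ^ (n div d)) -
      (\<Sum>d | d dvd p * n. of_nat d * wvar (h d) ^ (p * n div d))"
    by (rule ghost_sum_congruence[OF p]) auto
  then show "of_nat (p ^ multiplicity p (p * n)) dvd
      ghost_poly (\<lambda>d. wvar (h d)) (p * n) - frob_poly p (ghost_poly (\<lambda>d. wvar (h d)) n)"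
    by (subst dvd_minus_iff[symmetric])
       (simp add: ghost_poly_def frob_poly_sum frob_poly_mult frob_poly_of_nat frob_poly_power frob_poly_wvar)
qed

lemma coprime_of_nat_dvd_mult_cancel:
  fixes f :: "'a::comm_ring_1"
  assumes "coprime a b" "of_nat a dvd of_nat b * f"
  shows "of_nat a dvd f"
proof -
  obtain s t :: int where st: "s * int a + t * int b = 1"
    using bezout_int[of "int a" "int b"] \<open>coprime a b\<close> by auto
  have "f = of_int (s * int a + t * int b) * f"
    by (simp add: st)
  also have "\<dots> = of_nat a * (of_int s * f) + of_int t * (of_nat b * f)"
    by (simp add: algebra_simps)
  finally show ?thesis
    using assms(2) by (metis dvd_add dvd_mult dvd_triv_left)
qed

text \<open>Multiplied by \<open>p\<close>, the congruence for \<open>u\<close> at a prime \<open>q\<close> compares \<open>w (p * q * n)\<close> with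
  \<open>frob_poly q (w (p * n))\<close> and \<open>w (q * n) ^ p\<close> with \<open>frob_poly q (w n) ^ p\<close>. For \<open>q \<noteq> p\<close> the factor
  \<open>p\<close> can be cancelled. For \<open>q = p\<close> it costs one power of \<open>p\<close>, which is regained since the first
  congruence is for \<open>p * p * n\<close> and the second is improved by taking \<open>p\<close>-th powers.\<close>

lemma dwork_congruent_frobenius_quotient:
  assumes w: "dwork_congruent w" and "prime p"
    and u: "\<And>n. n > 0 \<Longrightarrow> w (p * n) - w n ^ p = of_nat p * u n"
  shows "dwork_congruent u"
  unfolding dwork_congruent_def
proof (intro allI impI)
  fix q n :: nat assume "prime q" "n > 0"
  let ?k = "multiplicity q (q * n)"
  have pos: "p * n > 0" "q * n > 0" "q > 0" "p > 0"
    using \<open>prime p\<close> \<open>prime q\<close> \<open>n > 0\<close> by (auto simp: prime_gt_0_nat)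
  have "of_nat p * (u (q * n) - frob_poly q (u n)) =
      (w (p * (q * n)) - w (q * n) ^ p) - frob_poly q (w (p * n) - w n ^ p)"
    using u[of n] u[of "q * n"] pos \<open>n > 0\<close>
    by (simp add: frob_poly_mult frob_poly_of_nat right_diff_distrib)
  also have "\<dots> = (w (q * (p * n)) - frob_poly q (w (p * n))) - (w (q * n) ^ p - frob_poly q (w n) ^ p)"
    by (simp add: frob_poly_diff frob_poly_power algebra_simps)
  finally have eq: "of_nat p * (u (q * n) - frob_poly q (u n)) = \<dots>" .
  have cong: "of_nat (q ^ ?k) dvd w (q * n) - frob_poly q (w n)"
    using w \<open>prime q\<close> \<open>n > 0\<close> by (rule dwork_congruentD)
  have cong_p: "of_nat (q ^ multiplicity q (q * (p * n))) dvd w (q * (p * n)) - frob_poly q (w (p * n))"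
    using w \<open>prime q\<close> pos(1) by (rule dwork_congruentD)
  show "of_nat (q ^ ?k) dvd u (q * n) - frob_poly q (u n)"
  proof (cases "q = p")
    case True
    have k: "?k = Suc (multiplicity q n)" "multiplicity q (q * (p * n)) = Suc ?k"
      using multiplicity_prime_times[OF \<open>prime q\<close>, of n]
        multiplicity_prime_times[OF \<open>prime q\<close>, of "p * n"] pos \<open>n > 0\<close> True by auto
    have "of_nat (q ^ Suc (Suc (multiplicity q n))) dvd w (q * n) ^ q - frob_poly q (w n) ^ q"
      using cong by (intro power_diff_dvd_step) (simp only: k(1))
    then have "of_nat (q ^ Suc ?k) dvd w (q * n) ^ p - frob_poly q (w n) ^ p"
      by (simp only: k(1)[unfolded True] True)
    from dvd_diff[OF cong_p[unfolded k(2)] this]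
    have "of_nat (q ^ Suc ?k) dvd of_nat p * (u (q * n) - frob_poly q (u n))"
      by (simp only: eq)
    then obtain g where "of_nat p * (u (q * n) - frob_poly q (u n)) = of_nat (q ^ Suc ?k) * g"
      by (rule dvdE)
    then have "of_nat p * (u (q * n) - frob_poly q (u n)) = of_nat p * (of_nat (q ^ ?k) * g)"
      by (simp add: True mult.assoc)
    then have "u (q * n) - frob_poly q (u n) = of_nat (q ^ ?k) * g"
      using pos(4) by (rule of_nat_mult_cancel)
    then show ?thesis
      by simp
  next
    case False
    have "coprime (q ^ ?k) p"
      using False \<open>prime p\<close> \<open>prime q\<close> by (auto simp: coprime_power_left_iff intro: primes_coprime)
    moreover have "of_nat (q ^ ?k) dvd w (q * n) ^ p - frob_poly q (w n) ^ p"
      using cong power_diff_dvd_diff by (rule dvd_trans)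
    moreover have "?k \<le> multiplicity q (q * (p * n))"
      using pos \<open>n > 0\<close> by (intro dvd_imp_multiplicity_le) auto
    then have "(of_nat (q ^ ?k) :: witt_poly) dvd of_nat (q ^ multiplicity q (q * (p * n)))"
      unfolding of_nat_power by (rule le_imp_power_dvd)
    then have "of_nat (q ^ ?k) dvd w (q * (p * n)) - frob_poly q (w (p * n))"
      using cong_p by (rule dvd_trans)
    ultimately show ?thesis
      using eq by (metis coprime_of_nat_dvd_mult_cancel dvd_diff)
  qed
qed

text \<open>For \<open>w = ghost_X\<close> the coordinates of \<open>u\<close> are the universal polynomials for
  \<open>(F\<^sub>p x - x ^ p) / p\<close>, which witness that \<open>F\<^sub>p\<close> lifts the Frobenius map on Witt vectors.\<close>

lemma ghost_frobenius_quotient: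
  assumes "dwork_congruent w" "prime p"
  shows "\<exists>u. dwork_congruent u \<and> (\<forall>n>0. w (p * n) = w n ^ p + of_nat p * u n)"
proof -
  have "\<exists>g. w (p * n) - w n ^ p = of_nat p * g" if "n > 0" for n
  proof -
    have "multiplicity p (p * n) = Suc (multiplicity p n)"
      using assms(2) that by (rule multiplicity_prime_times)
    then have "(of_nat p :: witt_poly) dvd of_nat (p ^ multiplicity p (p * n))"
      by simp
    also have "\<dots> dvd w (p * n) - frob_poly p (w n)"
      using assms that by (rule dwork_congruentD)
    finally have "of_nat p dvd (w (p * n) - frob_poly p (w n)) + (frob_poly p (w n) - w n ^ p)"
      using frob_poly_cong[OF assms(2)] by (rule dvd_add)
    then have "of_nat p dvd w (p * n) - w n ^ p"
      by simp
    then show ?thesis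
      by (rule dvdE) (rule exI)
  qed
  then obtain u where u: "\<And>n. n > 0 \<Longrightarrow> w (p * n) - w n ^ p = of_nat p * u n"
    by metis
  have "w (p * n) = w n ^ p + of_nat p * u n" if "n > 0" for n
    using u[OF that] by (simp add: algebra_simps)
  moreover have "dwork_congruent u"
    using assms u by (rule dwork_congruent_frobenius_quotient)
  ultimately show ?thesis
    by (intro exI conjI allI impI)
qed

section \<open>The ghost map on Witt vectors\<close>

lemma carrier_witt_ring: "carrier (witt_ring R S) = (\<Pi>\<^sub>E n\<in>S. carrier R)"
  by (simp add: witt_ring_def)

lemma witt_zero: "\<zero>\<^bsub>witt_ring R S\<^esub> = (\<lambda>n\<in>S. \<zero>\<^bsub>R\<^esub>)"
  by (simp add: witt_ring_def)

lemma witt_add: "x \<oplus>\<^bsub>witt_ring R S\<^esub> y = (\<lambda>n\<in>S. witt_eval R S x y (witt_add_poly n))"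
  by (simp add: witt_ring_def)

lemma witt_mult: "x \<otimes>\<^bsub>witt_ring R S\<^esub> y = (\<lambda>n\<in>S. witt_eval R S x y (witt_mult_poly n))"
  by (simp add: witt_ring_def)

lemma witt_one: "\<one>\<^bsub>witt_ring R S\<^esub> = (\<lambda>n\<in>S. if n = 1 then \<one>\<^bsub>R\<^esub> else \<zero>\<^bsub>R\<^esub>)"
  by (simp add: witt_ring_def)

locale witt_vectors = comm_rng R for R (structure) +
  fixes S :: "nat set"
  assumes stable: "divisor_stable S"
begin

abbreviation W :: "(nat \<Rightarrow> 'a) ring" where "W \<equiv> witt_ring R S"

definition substitution :: "(nat \<Rightarrow> 'a) \<Rightarrow> (nat \<Rightarrow> 'a) \<Rightarrow> nat + nat \<Rightarrow> 'a" where
  "substitution x y = case_sum (\<lambda>d. if d \<in> S then x d else \<zero>) (\<lambda>d. if d \<in> S then y d else \<zero>)"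

lemma substitution_simps:
  "d \<in> S \<Longrightarrow> substitution x y (Inl d) = x d"
  "d \<in> S \<Longrightarrow> substitution x y (Inr d) = y d"
  by (simp_all add: substitution_def)

lemma wpoly_substitution:
  assumes "x \<in> carrier W" "y \<in> carrier W"
  shows "wpoly_substitution R (substitution x y)"
proof
  fix i
  show "substitution x y i \<in> carrier R"
    using assms by (cases i) (auto simp: substitution_def carrier_witt_ring)
qed

lemma witt_eval_eq:
  assumes "x \<in> carrier W" "y \<in> carrier W"
  shows "witt_eval R S x y f = snd (wpoly_substitution.ueval R (substitution x y) f)"
proof -
  interpret V: wpoly_substitution R "substitution x y"
    using assms by (rule wpoly_substitution)
  have "(\<lambda>i. (0 :: int, substitution x y i)) =
      case_sum (\<lambda>d. (0, if d \<in> S then x d else \<zero>)) (\<lambda>d. (0, if d \<in> S then y d else \<zero>))"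
    by (auto simp: substitution_def split: sum.splits)
  then show ?thesis
    by (simp add: witt_eval_def V.ueval_def)
qed

lemma witt_eval_closed:
  assumes "x \<in> carrier W" "y \<in> carrier W"
  shows "witt_eval R S x y f \<in> carrier R"
proof -
  interpret V: wpoly_substitution R "substitution x y"
    using assms by (rule wpoly_substitution)
  show ?thesis
    unfolding witt_eval_eq[OF assms] by (rule V.ev_closed)
qed

lemma pos: "n \<in> S \<Longrightarrow> n > 0"
  using stable by (rule divisor_stable_pos)

lemma dvd: "n \<in> S \<Longrightarrow> d dvd n \<Longrightarrow> d \<in> S"
  using stable by (rule divisor_stable_dvd)

lemma ghost_nth: "n \<in> S \<Longrightarrow> ghost R S x n = (\<Oplus>d\<in>{d. d dvd n}. add_pow R d (rng_pow R (x d) (n div d)))"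
  by (simp add: ghost_def)

lemma ghost_at_1:
  assumes "x \<in> carrier W"
  shows "ghost R S x 1 = x 1"
proof -
  have "1 \<in> S" "x 1 \<in> carrier R"
    using assms one_mem_divisor_stable[OF stable] by (auto simp: carrier_witt_ring)
  then show ?thesis
    by (simp add: ghost_def)
qed

lemma ghost_terms_closed:
  assumes "x \<in> carrier W" "n \<in> S" "d dvd n"
  shows "add_pow R d (rng_pow R (x d) (n div d)) \<in> carrier R"
  using assms dvd[OF assms(2,3)] div_divisor_pos[OF pos[OF assms(2)] assms(3)]
  by (intro add.nat_pow_closed rng_pow_closed) (auto simp: carrier_witt_ring)

lemma ghost_closed: "x \<in> carrier W \<Longrightarrow> n \<in> S \<Longrightarrow> ghost R S x n \<in> carrier R"
  unfolding ghost_nth by (intro finsum_closed Pi_I) (auto intro: ghost_terms_closed)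

text \<open>The defining property of universal polynomials, evaluated in \<open>R\<close>: a Witt vector computed with
  \<open>witt_coords w\<close> has the values of \<open>w\<close> as ghost components. Sums, products,
  negatives and Frobenius images of Witt vectors are of this form. The index set \<open>S'\<close> of the result is independent of that of \<open>x\<close> and \<open>y\<close>, since
  \<open>F\<^sub>k\<close> takes values in vectors indexed by \<open>S \<oslash> k\<close>.\<close>

lemma ghost_witt_coords:
  assumes xy: "x \<in> carrier W" "y \<in> carrier W"
    and w: "dwork_congruent w" "\<And>n. n > 0 \<Longrightarrow> fst (wpoly_substitution.ueval R (substitution x y) (w n)) = 0"
    and S': "divisor_stable S'" "n \<in> S'"
  shows "ghost R S' (\<lambda>n\<in>S'. witt_eval R S x y (witt_coords w n)) n = witt_eval R S x y (w n)"
proof -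
  interpret V: wpoly_substitution R "substitution x y"
    using xy by (rule wpoly_substitution)
  have "n > 0"
    using S' by (rule divisor_stable_pos)
  have c: "V.const (witt_coords w d) = 0" if "d > 0" for d
    by (rule V.const_coordinate_zero[OF _ that]) (simp add: ghost_poly_witt_coords w)
  have "witt_eval R S x y (w n) = V.ev (ghost_poly (witt_coords w) n)"
    by (simp add: witt_eval_eq[OF xy] ghost_poly_witt_coords w \<open>n > 0\<close>)
  also have "\<dots> = (\<Oplus>d\<in>{d. d dvd n}. add_pow R d (rng_pow R (V.ev (witt_coords w d)) (n div d)))"
    using \<open>n > 0\<close> c dvd_pos_nat by (intro V.ev_ghost_poly) blast+
  also have "\<dots> = (\<Oplus>d\<in>{d. d dvd n}. add_pow R d
      (rng_pow R ((\<lambda>n\<in>S'. witt_eval R S x y (witt_coords w n)) d) (n div d)))"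
    using divisor_stable_dvd[OF S'] div_divisor_pos[OF \<open>n > 0\<close>]
    by (intro finsum_cong') (auto simp: witt_eval_eq[OF xy] intro!: rng_pow_closed V.ev_closed)
  finally show ?thesis
    using S' by (simp add: ghost_def)
qed

lemma ghost_variables:
  assumes xy: "x \<in> carrier W" "y \<in> carrier W"
  shows "n > 0 \<Longrightarrow> fst (wpoly_substitution.ueval R (substitution x y) (ghost_poly (\<lambda>d. wvar (h d)) n)) = 0"
    and "n \<in> S \<Longrightarrow> witt_eval R S x y (ghost_poly (\<lambda>d. wvar (Inl d)) n) = ghost R S x n"
    and "n \<in> S \<Longrightarrow> witt_eval R S x y (ghost_poly (\<lambda>d. wvar (Inr d)) n) = ghost R S y n"
proof -
  interpret V: wpoly_substitution R "substitution x y"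
    using xy by (rule wpoly_substitution)
  show "V.const (ghost_poly (\<lambda>d. wvar (h d)) n) = 0" if "n > 0" for n and h
    unfolding V.const_ghost_poly V.const_wvar
    using that div_divisor_pos[OF that] by (intro sum.neutral) auto
  show "witt_eval R S x y (ghost_poly (\<lambda>d. wvar (Inl d)) n) = ghost R S x n" if "n \<in> S"
    unfolding witt_eval_eq[OF xy] ghost_nth[OF that]
    by (subst V.ev_ghost_poly, simp add: that pos, simp add: V.const_wvar, rule finsum_cong')
       (use that dvd in \<open>auto simp: V.ev_wvar substitution_simps intro!: ghost_terms_closed xy\<close>)
  show "witt_eval R S x y (ghost_poly (\<lambda>d. wvar (Inr d)) n) = ghost R S y n" if "n \<in> S"
    unfolding witt_eval_eq[OF xy] ghost_nth[OF that]
    by (subst V.ev_ghost_poly, simp add: that pos, simp add: V.const_wvar, rule finsum_cong')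
       (use that dvd in \<open>auto simp: V.ev_wvar substitution_simps intro!: ghost_terms_closed xy\<close>)
qed

lemma witt_add_closed: "x \<in> carrier W \<Longrightarrow> y \<in> carrier W \<Longrightarrow> x \<oplus>\<^bsub>W\<^esub> y \<in> carrier W"
  by (simp add: witt_add) (simp add: carrier_witt_ring[of R S] witt_eval_closed)

lemma witt_mult_closed: "x \<in> carrier W \<Longrightarrow> y \<in> carrier W \<Longrightarrow> x \<otimes>\<^bsub>W\<^esub> y \<in> carrier W"
  by (simp add: witt_mult) (simp add: carrier_witt_ring[of R S] witt_eval_closed)

lemma witt_zero_closed: "\<zero>\<^bsub>W\<^esub> \<in> carrier W"
  by (simp add: witt_zero carrier_witt_ring)

lemma ghost_add:
  assumes xy: "x \<in> carrier W" "y \<in> carrier W" and "n \<in> S"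
  shows "ghost R S (x \<oplus>\<^bsub>W\<^esub> y) n = ghost R S x n \<oplus> ghost R S y n"
proof -
  interpret V: wpoly_substitution R "substitution x y"
    using xy by (rule wpoly_substitution)
  have "ghost R S (x \<oplus>\<^bsub>W\<^esub> y) n =
      witt_eval R S x y (ghost_poly (\<lambda>d. wvar (Inl d)) n + ghost_poly (\<lambda>d. wvar (Inr d)) n)"
    unfolding witt_add witt_add_poly_def using \<open>n \<in> S\<close>
    by (intro ghost_witt_coords xy stable dwork_congruent_add dwork_congruent_ghost_wvar)
       (simp_all add: V.const_add ghost_variables[OF xy])
  also have "\<dots> = ghost R S x n \<oplus> ghost R S y n"
    using ghost_variables[OF xy] \<open>n \<in> S\<close> by (simp add: witt_eval_eq[OF xy] V.ev_add)
  finally show ?thesis .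
qed

lemma ghost_mult:
  assumes xy: "x \<in> carrier W" "y \<in> carrier W" and "n \<in> S"
  shows "ghost R S (x \<otimes>\<^bsub>W\<^esub> y) n = ghost R S x n \<otimes> ghost R S y n"
proof -
  interpret V: wpoly_substitution R "substitution x y"
    using xy by (rule wpoly_substitution)
  have "ghost R S (x \<otimes>\<^bsub>W\<^esub> y) n =
      witt_eval R S x y (ghost_poly (\<lambda>d. wvar (Inl d)) n * ghost_poly (\<lambda>d. wvar (Inr d)) n)"
    unfolding witt_mult witt_mult_poly_def using \<open>n \<in> S\<close>
    by (intro ghost_witt_coords xy stable dwork_congruent_mult dwork_congruent_ghost_wvar)
       (simp_all add: V.const_mult ghost_variables[OF xy])
  also have "\<dots> = ghost R S x n \<otimes> ghost R S y n"
    using ghost_variables[OF xy] \<open>n \<in> S\<close> pos by (simp add: witt_eval_eq[OF xy] V.ev_mult)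
  finally show ?thesis .
qed

lemma ghost_zero: "n \<in> S \<Longrightarrow> ghost R S \<zero>\<^bsub>W\<^esub> n = \<zero>"
proof -
  have zero: "rng_pow R \<zero> k = \<zero>" if "k > 0" for k
    using that by (induction k rule: nat_induct_non_zero) (auto simp: rng_pow_Suc r_null)
  assume "n \<in> S"
  then show ?thesis
    using dvd[of n] div_divisor_pos[OF pos, of n]
    by (auto simp: ghost_nth witt_zero zero intro!: add.finprod_one_eqI)
qed

lemma ghost_uminus_ex:
  assumes x: "x \<in> carrier W"
  shows "\<exists>y\<in>carrier W. \<forall>n\<in>S. ghost R S y n = \<ominus> ghost R S x n"
proof -
  interpret V: wpoly_substitution R "substitution x x"
    using x x by (rule wpoly_substitution)
  \<comment> \<open>Negation is given by universal polynomials too, with ghost components \<open>- ghost_X n\<close>.\<close>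
  let ?y = "\<lambda>n\<in>S. witt_eval R S x x (witt_coords (\<lambda>n. - ghost_poly (\<lambda>d. wvar (Inl d)) n) n)"
  have "ghost R S ?y n = witt_eval R S x x (- ghost_poly (\<lambda>d. wvar (Inl d)) n)" if "n \<in> S" for n
    using that
    by (intro ghost_witt_coords x stable dwork_congruent_uminus dwork_congruent_ghost_wvar)
       (simp_all add: V.const_uminus ghost_variables[OF x x])
  moreover have "witt_eval R S x x (- ghost_poly (\<lambda>d. wvar (Inl d)) n) = \<ominus> ghost R S x n" if "n \<in> S" for n
  proof (rule minus_equality[symmetric])
    show "witt_eval R S x x (- ghost_poly (\<lambda>d. wvar (Inl d)) n) \<oplus> ghost R S x n = \<zero>"
      using V.ev_add[of "- ghost_poly (\<lambda>d. wvar (Inl d)) n" "ghost_poly (\<lambda>d. wvar (Inl d)) n"]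
      by (simp add: witt_eval_eq[OF x x] V.ueval_zero flip: ghost_variables(2)[OF x x that])
  qed (use that x in \<open>auto intro: ghost_closed witt_eval_closed\<close>)
  ultimately show ?thesis
    using x by (intro bexI[of _ ?y]) (simp_all add: carrier_witt_ring[of R S] witt_eval_closed)
qed

lemma witt_frob_closed:
  assumes "x \<in> carrier W"
  shows "witt_frob R k S x \<in> carrier (witt_ring R (S \<oslash> k))"
  using assms by (simp add: witt_frob_def carrier_witt_ring[of R "S \<oslash> k"] witt_eval_closed)

lemma ghost_frob:
  assumes x: "x \<in> carrier W" and "k \<in> S" "n \<in> S \<oslash> k"
  shows "ghost R (S \<oslash> k) (witt_frob R k S x) n = ghost R S x (k * n)"
proof -
  interpret V: wpoly_substitution R "substitution x x"
    using x x by (rule wpoly_substitution)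
  have "k * n \<in> S"
    using assms mem_ds_quot[OF stable] by (simp add: mult.commute)
  have "ghost R (S \<oslash> k) (witt_frob R k S x) n = witt_eval R S x x (ghost_poly (\<lambda>d. wvar (Inl d)) (k * n))"
    unfolding witt_frob_def witt_frob_poly_def
    using assms pos[OF \<open>k \<in> S\<close>]
    by (intro ghost_witt_coords x stable divisor_stable_quot dwork_congruent_shift dwork_congruent_ghost_wvar)
       (simp_all add: ghost_variables[OF x x])
  also have "\<dots> = ghost R S x (k * n)"
    using \<open>k * n \<in> S\<close> by (rule ghost_variables(2)[OF x x])
  finally show ?thesis .
qed

lemma ghost_restrict:
  assumes "x \<in> carrier W" "S' \<preceq> S" "n \<in> S'"
  shows "ghost R S' (restrict x S') n = ghost R S x n"
proof -
  have "d \<in> S'" if "d dvd n" for d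
    using assms that by (meson divisor_stable_dvd ds_subset_stable)
  moreover have "n \<in> S"
    using assms by (auto simp: ds_subset_def)
  ultimately show ?thesis
    using assms by (auto simp: ghost_def intro!: finsum_cong' ghost_terms_closed)
qed

lemma frob_cong_ghost:
  assumes x: "x \<in> carrier W" and p: "prime p" "p \<in> S"
  shows "\<exists>b\<in>carrier (witt_ring R (S \<oslash> p)). \<forall>n\<in>S \<oslash> p.
    ghost R S x (p * n) = rng_pow R (ghost R S x n) p \<oplus> add_pow R p (ghost R (S \<oslash> p) b n)"
proof -
  interpret V: wpoly_substitution R "substitution x x"
    using x x by (rule wpoly_substitution)
  let ?g = "ghost_poly (\<lambda>d. wvar (Inl d))"
  obtain u where u: "dwork_congruent u" "\<And>n. n > 0 \<Longrightarrow> ?g (p * n) = ?g n ^ p + of_nat p * u n"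
    using ghost_frobenius_quotient[OF dwork_congruent_ghost_wvar p(1)] by blast
  have g0: "V.const (?g n) = 0" if "n > 0" for n
    using that by (rule ghost_variables(1)[OF x x])
  have "p > 0"
    using p(1) by (rule prime_gt_0_nat)
  have u0: "V.const (u n) = 0" if "n > 0" for n
    using arg_cong[OF u(2)[OF that], of V.const] that g0 \<open>p > 0\<close>
    by (simp add: V.const_add V.const_mult V.const_power V.const_of_nat power_0_left)
  define b where "b = (\<lambda>n\<in>S \<oslash> p. witt_eval R S x x (witt_coords u n))"
  have "ghost R S x (p * n) = rng_pow R (ghost R S x n) p \<oplus> add_pow R p (ghost R (S \<oslash> p) b n)"
    if "n \<in> S \<oslash> p" for n
  proof -
    have n: "n \<in> S" "p * n \<in> S" "n > 0"
      using that pos by (auto simp: ds_quot_def mult.commute)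
    have "ghost R (S \<oslash> p) b n = V.ev (u n)"
      unfolding b_def witt_eval_eq[OF x x, symmetric] using that p
      by (intro ghost_witt_coords x u u0 divisor_stable_quot stable)
    moreover have "V.ev (?g (p * n)) = rng_pow R (V.ev (?g n)) p \<oplus> add_pow R p (V.ev (u n))"
      using n \<open>p > 0\<close> by (simp add: u(2) V.ev_add V.ev_of_nat_mult V.ev_power g0)
    ultimately show ?thesis
      using n by (simp add: witt_eval_eq[OF x x] flip: ghost_variables(2)[OF x x])
  qed
  moreover have "b \<in> carrier (witt_ring R (S \<oslash> p))"
    using x by (simp add: b_def carrier_witt_ring[of R "S \<oslash> p"] witt_eval_closed)
  ultimately show ?thesis
    by blast
qed

end

locale torsion_free_witt_vectors = witt_vectors +
  assumes torsion_free: "no_torsion S R"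
begin

text \<open>The ghost map determines the coordinates recursively, since the \<open>n\<close>-th ghost component is
  \<open>n\<close> times the \<open>n\<close>-th coordinate plus terms in the earlier ones, and \<open>n\<close> can be cancelled. This
  reduces identities between Witt vectors to identities between ghost components.\<close>

lemma witt_eqI:
  assumes xy: "x \<in> carrier W" "y \<in> carrier W"
    and eq: "\<And>n. n \<in> S \<Longrightarrow> ghost R S x n = ghost R S y n"
  shows "x = y"
proof (rule PiE_ext)
  show "x \<in> S \<rightarrow>\<^sub>E carrier R" "y \<in> S \<rightarrow>\<^sub>E carrier R"
    using xy by (simp_all add: carrier_witt_ring)
  fix n assume "n \<in> S"
  then show "x n = y n"
  proof (induction n rule: less_induct)
    case (less n)
    have "n > 0"
      using less.prems by (rule pos)
    let ?s = "\<lambda>x. \<Oplus>d\<in>{d. d dvd n \<and> d < n}. add_pow R d (rng_pow R (x d) (n div d))"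
    have split: "ghost R S z n = ?s z \<oplus> add_pow R n (z n)" "?s z \<in> carrier R" "z n \<in> carrier R"
      if "z \<in> carrier W" for z
    proof -
      show "?s z \<in> carrier R"
        using that less.prems by (intro finsum_closed Pi_I) (auto intro: ghost_terms_closed)
      then show "ghost R S z n = ?s z \<oplus> add_pow R n (z n)"
        unfolding ghost_nth[OF less.prems] sum_divisors_split[OF \<open>n > 0\<close>]
        using that less.prems ghost_terms_closed[OF that less.prems] ghost_terms_closed[OF that less.prems dvd_refl] \<open>n > 0\<close>
        by (subst finsum_insert) (auto simp: a_comm)
      show "z n \<in> carrier R"
        using that less.prems by (auto simp: carrier_witt_ring)
    qed
    have "?s x = ?s y"
      using less dvd xy by (intro finsum_cong') (auto intro!: ghost_terms_closed)
    then have "add_pow R n (x n) = add_pow R n (y n)"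
      using eq[OF less.prems] split[OF xy(1)] split[OF xy(2)] by simp
    then show ?case
      using torsion_free less.prems split(3)[OF xy(1)] split(3)[OF xy(2)]
      by (auto simp: no_torsion_def dest: inj_onD)
  qed
qed

lemma ghost_inj: "inj_on (ghost R S) (carrier W)"
  by (intro inj_onI witt_eqI) auto

lemma comm_rng_witt_ring: "comm_rng W"
proof (rule comm_rng.intro)
  show "abelian_group W"
  proof (rule abelian_groupI)
    fix x assume x: "x \<in> carrier W"
    then obtain y where y: "y \<in> carrier W" "\<forall>n\<in>S. ghost R S y n = \<ominus> ghost R S x n"
      using ghost_uminus_ex by blast
    have "y \<oplus>\<^bsub>W\<^esub> x = \<zero>\<^bsub>W\<^esub>"
      using x y by (intro witt_eqI) (auto simp: ghost_add ghost_zero ghost_closed l_neg witt_add_closed witt_zero_closed)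
    with y show "\<exists>y\<in>carrier W. y \<oplus>\<^bsub>W\<^esub> x = \<zero>\<^bsub>W\<^esub>"
      by blast
  qed (auto intro!: witt_eqI simp: ghost_add ghost_zero ghost_closed witt_add_closed witt_zero_closed a_ac)
  show "comm_rng_axioms W"
    by (rule comm_rng_axioms.intro)
       (auto intro!: witt_eqI simp: ghost_add ghost_mult ghost_closed witt_add_closed witt_mult_closed m_assoc m_comm l_distr m_lcomm r_distr)
qed

lemma ghost_hom: "n \<in> S \<Longrightarrow> (\<lambda>x. ghost R S x n) \<in> rng_hom W R"
  by (auto simp: rng_hom_def ghost_add ghost_mult ghost_closed)

lemma comm_rng_hom_ghost: "n \<in> S \<Longrightarrow> comm_rng_hom W R (\<lambda>x. ghost R S x n)"
  by (intro comm_rng_hom.intro comm_rng_hom_axioms.intro comm_rng_witt_ring comm_rng_axioms ghost_hom)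

end

section \<open>Witt vectors as an object of \<open>RF\<^sub>T\<close>\<close>

lemma no_torsion_subset: "no_torsion T R \<Longrightarrow> S \<subseteq> T \<Longrightarrow> no_torsion S R"
  by (auto simp: no_torsion_def)

lemma (in witt_vectors) ghost_one:
  assumes "is_ring True R" "n \<in> S"
  shows "ghost R S \<one>\<^bsub>W\<^esub> n = \<one>"
proof -
  have one: "\<one> \<in> carrier R" "\<And>a. a \<in> carrier R \<Longrightarrow> \<one> \<otimes> a = a"
    using assms(1) by (auto simp: is_ring_iff)
  have one_pow: "rng_pow R \<one> k = \<one>" if "k > 0" for k
    using that by (induction k rule: nat_induct_non_zero) (auto simp: rng_pow_Suc one)
  have zero_pow: "rng_pow R \<zero> k = \<zero>" if "k > 0" for k
    using that by (induction k rule: nat_induct_non_zero) (auto simp: rng_pow_Suc r_null)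
  have "ghost R S \<one>\<^bsub>W\<^esub> n = (\<Oplus>d\<in>{d. d dvd n}. if 1 = d then \<one> else \<zero>)"
    unfolding ghost_nth[OF assms(2)] using dvd[OF assms(2)] div_divisor_pos[OF pos[OF assms(2)]] pos[OF assms(2)]
    by (intro finsum_cong') (auto simp: witt_one one one_pow zero_pow)
  also have "\<dots> = \<one>"
    using pos[OF assms(2)] one by (intro add.finprod_singleton) (auto simp: finite_divisors)
  finally show ?thesis .
qed

lemma restrict_witt_closed:
  "x \<in> carrier (witt_ring R S) \<Longrightarrow> S' \<subseteq> S \<Longrightarrow> restrict x S' \<in> carrier (witt_ring R S')"
  by (auto simp: carrier_witt_ring)

lemma witt_system_simps [simp]:
  "rf_ring (witt_system R) = witt_ring R"
  "rf_res (witt_system R) S2 S1 x = restrict x S1"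
  "rf_frob (witt_system R) = witt_frob R"
  by (simp_all add: witt_system_def)

lemma witt_one_closed:
  assumes "is_ring True R"
  shows "\<one>\<^bsub>witt_ring R S\<^esub> \<in> carrier (witt_ring R S)"
proof -
  interpret comm_rng R
    using assms by (simp add: is_ring_iff)
  show ?thesis
    using assms by (simp add: is_ring_iff witt_one carrier_witt_ring[of R S])
qed

lemma torsion_free_witt_vectorsI:
  assumes "is_ring u R" "no_torsion T R" "S \<preceq> T"
  shows "torsion_free_witt_vectors R S"
proof -
  have "comm_rng R" "divisor_stable S" "no_torsion S R"
    using assms by (auto simp: is_ring_iff ds_subset_def intro: no_torsion_subset)
  then show ?thesis
    by (intro torsion_free_witt_vectors.intro witt_vectors.intro witt_vectors_axioms.intro
        torsion_free_witt_vectors_axioms.intro)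
qed

context torsion_free_witt_vectors begin

lemma quotient: "n \<in> S \<Longrightarrow> torsion_free_witt_vectors R (S \<oslash> n)"
  using stable torsion_free
  by (intro torsion_free_witt_vectors.intro witt_vectors.intro witt_vectors_axioms.intro
      torsion_free_witt_vectors_axioms.intro comm_rng_axioms divisor_stable_quot)
     (auto simp: no_torsion_def ds_quot_def)

lemma witt_frob_commute:
  assumes x: "x \<in> carrier W" and "p * l \<in> S"
  shows "witt_frob R l (S \<oslash> p) (witt_frob R p S x) = witt_frob R p (S \<oslash> l) (witt_frob R l S x)"
proof -
  have mem: "p \<in> S" "l \<in> S"
    using dvd[OF assms(2)] by auto
  interpret Wp: torsion_free_witt_vectors R "S \<oslash> p"
    using mem(1) by (rule quotient)
  interpret Wl: torsion_free_witt_vectors R "S \<oslash> l"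
    using mem(2) by (rule quotient)
  interpret Wpl: torsion_free_witt_vectors R "S \<oslash> (p * l)"
    using assms(2) by (rule quotient)
  have quot: "S \<oslash> p \<oslash> l = S \<oslash> (p * l)" "S \<oslash> l \<oslash> p = S \<oslash> (p * l)"
    by (simp_all add: ds_quot_quot stable mult.commute)
  have mem': "l \<in> S \<oslash> p" "p \<in> S \<oslash> l"
    using assms(2) by (simp_all add: mem_ds_quot stable mult.commute)
  show ?thesis
  proof (rule Wpl.witt_eqI)
    show "witt_frob R l (S \<oslash> p) (witt_frob R p S x) \<in> carrier (witt_ring R (S \<oslash> (p * l)))"
      using Wp.witt_frob_closed[OF witt_frob_closed[OF x], of l] by (simp add: quot)
    show "witt_frob R p (S \<oslash> l) (witt_frob R l S x) \<in> carrier (witt_ring R (S \<oslash> (p * l)))"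
      using Wl.witt_frob_closed[OF witt_frob_closed[OF x], of p] by (simp add: quot)
    fix n assume n: "n \<in> S \<oslash> (p * l)"
    then have ln: "l * n \<in> S \<oslash> p" "p * n \<in> S \<oslash> l"
      by (simp_all add: mem_ds_quot stable ac_simps)
    show "ghost R (S \<oslash> (p * l)) (witt_frob R l (S \<oslash> p) (witt_frob R p S x)) n =
        ghost R (S \<oslash> (p * l)) (witt_frob R p (S \<oslash> l) (witt_frob R l S x)) n"
      using Wp.ghost_frob[OF witt_frob_closed[OF x] mem'(1), of n]
        Wl.ghost_frob[OF witt_frob_closed[OF x] mem'(2), of n]
        ghost_frob[OF x mem(1) ln(1)] ghost_frob[OF x mem(2) ln(2)] n
      by (simp add: quot mult.left_commute)
  qed
qed

end

text \<open>Apart from closure and the functoriality of restriction, each axiom is an identity between Witt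
  vectors over a torsion-free ring, and hence follows from
  the description of the structure maps on ghost components: restriction restricts the family,
  and \<open>F\<^sub>p\<close> shifts it by \<open>p\<close>. The congruence \<open>frob_cong\<close> uses the vector from \<open>frob_cong_ghost\<close>.\<close>

lemma rf_object_witt_system:
  assumes R: "is_ring u R" and torsion: "no_torsion T R"
  shows "rf_object u T (witt_system R)"
proof
  note tf = torsion_free_witt_vectorsI[OF R torsion]
  fix S assume S: "S \<preceq> T"
  interpret W: torsion_free_witt_vectors R S
    using S by (rule tf)
  show "is_ring u (rf_ring (witt_system R) S)"
    unfolding is_ring_iff
  proof (intro conjI impI ballI)
    show "comm_rng (rf_ring (witt_system R) S)"
      by (simp add: W.comm_rng_witt_ring)
    assume u
    with R have R1: "is_ring True R"
      by simp
    then show "\<one>\<^bsub>rf_ring (witt_system R) S\<^esub> \<in> carrier (rf_ring (witt_system R) S)"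
      by (simp add: witt_one_closed)
    fix x assume x: "x \<in> carrier (rf_ring (witt_system R) S)"
    have "\<one>\<^bsub>R\<^esub> \<otimes>\<^bsub>R\<^esub> a = a" if "a \<in> carrier R" for a
      using that R1 by (auto simp: is_ring_iff)
    with x show "\<one>\<^bsub>rf_ring (witt_system R) S\<^esub> \<otimes>\<^bsub>rf_ring (witt_system R) S\<^esub> x = x"
      by (auto intro!: W.witt_eqI W.witt_mult_closed witt_one_closed[OF R1]
          simp: W.ghost_mult W.ghost_one[OF R1] W.ghost_closed witt_one_closed[OF R1])
  qed
  show "rf_res (witt_system R) S S x = x" if "x \<in> carrier (rf_ring (witt_system R) S)" for x
    using that by (auto simp: carrier_witt_ring PiE_restrict)
  fix p assume p: "prime p" "p \<in> S"
  interpret Wp: torsion_free_witt_vectors R "S \<oslash> p"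
    using ds_quot_subset[OF S p(2)] by (rule tf)
  have pn: "p * n \<in> S" if "n \<in> S \<oslash> p" for n
    using that by (simp add: ds_quot_def mult.commute)
  have in_S: "n \<in> S" if "n \<in> S \<oslash> p" for n
    using that by (simp add: ds_quot_def)
  show "rf_frob (witt_system R) p S \<in> homs u (rf_ring (witt_system R) S) (rf_ring (witt_system R) (S \<oslash> p))"
    unfolding homs_iff
  proof (intro conjI impI)
    show "rf_frob (witt_system R) p S \<in> rng_hom (rf_ring (witt_system R) S) (rf_ring (witt_system R) (S \<oslash> p))"
      by (auto simp: rng_hom_def W.witt_frob_closed W.witt_add_closed W.witt_mult_closed
          Wp.witt_add_closed Wp.witt_mult_closed W.ghost_frob p pn
          W.ghost_add W.ghost_mult Wp.ghost_add Wp.ghost_mult intro!: Wp.witt_eqI)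
    assume u
    with R have R1: "is_ring True R"
      by simp
    show "rf_frob (witt_system R) p S \<one>\<^bsub>rf_ring (witt_system R) S\<^esub> = \<one>\<^bsub>rf_ring (witt_system R) (S \<oslash> p)\<^esub>"
      by (auto simp: W.witt_frob_closed witt_one_closed[OF R1] W.ghost_frob p pn
          W.ghost_one[OF R1] Wp.ghost_one[OF R1] intro!: Wp.witt_eqI)
  qed
  fix x assume "x \<in> carrier (rf_ring (witt_system R) S)"
  then have x: "x \<in> carrier (witt_ring R S)"
    by simp
  have xp: "restrict x (S \<oslash> p) \<in> carrier (witt_ring R (S \<oslash> p))"
    using x by (rule restrict_witt_closed) (auto simp: ds_quot_def)
  obtain b where b: "b \<in> carrier (witt_ring R (S \<oslash> p))"
    "\<And>n. n \<in> S \<oslash> p \<Longrightarrow>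
      ghost R S x (p * n) = rng_pow R (ghost R S x n) p \<oplus>\<^bsub>R\<^esub> add_pow R p (ghost R (S \<oslash> p) b n)"
    using W.frob_cong_ghost[OF x p] by blast
  have "witt_frob R p S x = rng_pow (witt_ring R (S \<oslash> p)) (restrict x (S \<oslash> p)) p
      \<oplus>\<^bsub>witt_ring R (S \<oslash> p)\<^esub> add_pow (witt_ring R (S \<oslash> p)) p b"
  proof (rule Wp.witt_eqI)
    interpret Wring: comm_rng "witt_ring R (S \<oslash> p)"
      by (rule Wp.comm_rng_witt_ring)
    have pow: "rng_pow (witt_ring R (S \<oslash> p)) (restrict x (S \<oslash> p)) p \<in> carrier (witt_ring R (S \<oslash> p))"
      using xp prime_gt_0_nat[OF p(1)] by (rule Wring.rng_pow_closed)
    show "rng_pow (witt_ring R (S \<oslash> p)) (restrict x (S \<oslash> p)) p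
      \<oplus>\<^bsub>witt_ring R (S \<oslash> p)\<^esub> add_pow (witt_ring R (S \<oslash> p)) p b \<in> carrier (witt_ring R (S \<oslash> p))"
      using pow b(1) by simp
    show "witt_frob R p S x \<in> carrier (witt_ring R (S \<oslash> p))"
      using x by (rule W.witt_frob_closed)
    fix n assume n: "n \<in> S \<oslash> p"
    interpret gh: comm_rng_hom "witt_ring R (S \<oslash> p)" R "\<lambda>x. ghost R (S \<oslash> p) x n"
      using n by (rule Wp.comm_rng_hom_ghost)
    have "ghost R (S \<oslash> p) (restrict x (S \<oslash> p)) n = ghost R S x n"
      using x n p by (intro W.ghost_restrict ds_quot_subset_self W.stable)
    then show "ghost R (S \<oslash> p) (witt_frob R p S x) n =
        ghost R (S \<oslash> p) (rng_pow (witt_ring R (S \<oslash> p)) (restrict x (S \<oslash> p)) p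
          \<oplus>\<^bsub>witt_ring R (S \<oslash> p)\<^esub> add_pow (witt_ring R (S \<oslash> p)) p b) n"
      using n p x b pow xp prime_gt_0_nat[OF p(1)]
      by (simp add: W.ghost_frob gh.add gh.rng_pow gh.add_pow)
  qed
  with b(1) show "\<exists>b\<in>carrier (rf_ring (witt_system R) (S \<oslash> p)). rf_frob (witt_system R) p S x =
      rng_pow (rf_ring (witt_system R) (S \<oslash> p)) (rf_res (witt_system R) S (S \<oslash> p) x) p
        \<oplus>\<^bsub>rf_ring (witt_system R) (S \<oslash> p)\<^esub> add_pow (rf_ring (witt_system R) (S \<oslash> p)) p b"
    by auto
next
  note tf = torsion_free_witt_vectorsI[OF R torsion]
  fix S p l x
  assume S: "S \<preceq> T" and "p * l \<in> S" "x \<in> carrier (rf_ring (witt_system R) S)"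
  then show "rf_frob (witt_system R) l (S \<oslash> p) (rf_frob (witt_system R) p S x) =
      rf_frob (witt_system R) p (S \<oslash> l) (rf_frob (witt_system R) l S x)"
    using torsion_free_witt_vectors.witt_frob_commute[OF tf[OF S]] by simp
next
  note tf = torsion_free_witt_vectorsI[OF R torsion]
  fix S1 S2 assume S: "S1 \<preceq> S2" "S2 \<preceq> T"
  then have "S1 \<preceq> T"
    by (rule ds_subset_trans)
  interpret W1: torsion_free_witt_vectors R S1
    using \<open>S1 \<preceq> T\<close> by (rule tf)
  interpret W2: torsion_free_witt_vectors R S2
    using S(2) by (rule tf)
  have sub: "S1 \<subseteq> S2"
    using S by (simp add: ds_subset_def)
  show "rf_res (witt_system R) S2 S1 \<in> homs u (rf_ring (witt_system R) S2) (rf_ring (witt_system R) S1)"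
    unfolding homs_iff
  proof (intro conjI impI)
    show "rf_res (witt_system R) S2 S1 \<in> rng_hom (rf_ring (witt_system R) S2) (rf_ring (witt_system R) S1)"
      using sub by (auto simp: rng_hom_def restrict_witt_closed[where S = S2] W2.witt_add_closed W2.witt_mult_closed
          W1.witt_add_closed W1.witt_mult_closed W2.ghost_restrict S subsetD
          W1.ghost_add W1.ghost_mult W2.ghost_add W2.ghost_mult simp del: restrict_apply intro!: W1.witt_eqI)
    show "rf_res (witt_system R) S2 S1 \<one>\<^bsub>rf_ring (witt_system R) S2\<^esub> = \<one>\<^bsub>rf_ring (witt_system R) S1\<^esub>"
      using sub by (auto simp: witt_one restrict_def fun_eq_iff)
  qed
  fix p and x assume p: "prime p" "p \<in> S1" and "x \<in> carrier (rf_ring (witt_system R) S2)"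
  then have x: "x \<in> carrier (witt_ring R S2)"
    by simp
  have "p \<in> S2"
    using p sub by blast
  interpret W1p: torsion_free_witt_vectors R "S1 \<oslash> p"
    using ds_quot_subset[OF \<open>S1 \<preceq> T\<close> p(2)] by (rule tf)
  interpret W2p: torsion_free_witt_vectors R "S2 \<oslash> p"
    using ds_quot_subset[OF S(2) \<open>p \<in> S2\<close>] by (rule tf)
  have sub_p: "S1 \<oslash> p \<preceq> S2 \<oslash> p"
    using S(1) p(2) by (rule ds_quot_mono)
  have "restrict (witt_frob R p S2 x) (S1 \<oslash> p) = witt_frob R p S1 (restrict x S1)"
  proof (rule W1p.witt_eqI)
    show "restrict (witt_frob R p S2 x) (S1 \<oslash> p) \<in> carrier (witt_ring R (S1 \<oslash> p))"
      using W2.witt_frob_closed[OF x] sub_p by (auto simp: ds_subset_def intro: restrict_witt_closed)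
    show "witt_frob R p S1 (restrict x S1) \<in> carrier (witt_ring R (S1 \<oslash> p))"
      using x sub by (intro W1.witt_frob_closed restrict_witt_closed)
    fix n assume n: "n \<in> S1 \<oslash> p"
    have n': "n \<in> S2 \<oslash> p" "p * n \<in> S1"
      using n sub_p by (auto simp: ds_subset_def ds_quot_def mult.commute)
    show "ghost R (S1 \<oslash> p) (restrict (witt_frob R p S2 x) (S1 \<oslash> p)) n =
        ghost R (S1 \<oslash> p) (witt_frob R p S1 (restrict x S1)) n"
      using W2p.ghost_restrict[OF W2.witt_frob_closed[OF x] sub_p n] W2.ghost_frob[OF x \<open>p \<in> S2\<close> n'(1)]
        W1.ghost_frob[OF restrict_witt_closed[OF x sub] p(2) n] W2.ghost_restrict[OF x S(1) n'(2)]
      by simp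
  qed
  then show "rf_res (witt_system R) (S2 \<oslash> p) (S1 \<oslash> p) (rf_frob (witt_system R) p S2 x) =
      rf_frob (witt_system R) p S1 (rf_res (witt_system R) S2 S1 x)"
    by simp
next
  fix S1 S2 S3 x assume "S1 \<preceq> S2" "S2 \<preceq> S3"
  then show "rf_res (witt_system R) S2 S1 (rf_res (witt_system R) S3 S2 x) = rf_res (witt_system R) S3 S1 x"
    by (auto simp: ds_subset_def restrict_def fun_eq_iff)
qed

section \<open>The universal morphism\<close>

lemma ghost_witt_map:
  assumes "comm_rng R" "comm_rng Q" "h \<in> rng_hom R Q" "divisor_stable S"
    "x \<in> carrier (witt_ring R S)" "n \<in> S"
  shows "ghost Q S (witt_map h S x) n = h (ghost R S x n)"
proof -
  interpret R: witt_vectors R S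
    using assms by (intro witt_vectors.intro witt_vectors_axioms.intro)
  interpret h: comm_rng_hom R Q h
    using assms by (intro comm_rng_hom.intro comm_rng_hom_axioms.intro)
  have n: "n > 0" "n div d > 0" "d \<in> S" "x d \<in> carrier R" if "d dvd n" for d
    using R.pos[OF \<open>n \<in> S\<close>] that div_divisor_pos[of n d] R.dvd[OF \<open>n \<in> S\<close> that] assms(5)
    by (auto simp: carrier_witt_ring)
  have "h (ghost R S x n) =
      (\<Oplus>\<^bsub>Q\<^esub>d\<in>{d. d dvd n}. h (add_pow R d (rng_pow R (x d) (n div d))))"
    unfolding R.ghost_nth[OF \<open>n \<in> S\<close>] using assms by (intro h.finsum) (auto intro: R.ghost_terms_closed)
  also have "\<dots> = (\<Oplus>\<^bsub>Q\<^esub>d\<in>{d. d dvd n}. add_pow Q d (rng_pow Q (witt_map h S x d) (n div d)))"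
    using n by (intro h.cod.finsum_cong' Pi_I h.cod.add.nat_pow_closed h.cod.rng_pow_closed)
      (auto simp: witt_map_def h.add_pow h.rng_pow R.rng_pow_closed h.closed)
  finally show ?thesis
    using \<open>n \<in> S\<close> by (simp add: ghost_def)
qed

lemma witt_map_closed:
  "h \<in> rng_hom R Q \<Longrightarrow> x \<in> carrier (witt_ring R S) \<Longrightarrow> witt_map h S x \<in> carrier (witt_ring Q S)"
  by (auto simp: witt_map_def carrier_witt_ring rng_hom_def)

lemma (in rf_morphism) frob_list:
  assumes "S \<preceq> T" "\<forall>p\<in>set ps. prime p" "prod_list ps \<in> S" "a \<in> carrier (rf_ring A S)"
  shows "\<phi> (S \<oslash> prod_list ps) (rf_frob_list A ps S a) = rf_frob_list B ps S (\<phi> S a)"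
  using assms
proof (induction ps arbitrary: S a)
  case (Cons p ps)
  have S: "divisor_stable S"
    using Cons.prems ds_subset_stable by blast
  have p: "prime p" "p \<in> S"
    using divisor_stable_dvd[OF S Cons.prems(3)] Cons.prems by auto
  have "\<phi> (S \<oslash> p \<oslash> prod_list ps) (rf_frob_list A ps (S \<oslash> p) (rf_frob A p S a)) =
      rf_frob_list B ps (S \<oslash> p) (\<phi> (S \<oslash> p) (rf_frob A p S a))"
    using Cons.prems p
    by (intro Cons.IH) (auto simp: ds_quot_subset mem_ds_quot S dom.frob_closed ac_simps)
  then show ?case
    using frob[OF Cons.prems(1) p] Cons.prems by (simp add: ds_quot_quot S)
qed simp

lemma (in rf_morphism) frob_nat:
  assumes "S \<preceq> T" "n \<in> S" "a \<in> carrier (rf_ring A S)"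
  shows "\<phi> (S \<oslash> n) (rf_frob_nat A n S a) = rf_frob_nat B n S (\<phi> S a)"
proof -
  have "n > 0"
    using assms ds_subset_stable divisor_stable_pos by blast
  then show ?thesis
    using frob_list[OF assms(1) factor_list(1)[of n]] assms factor_list(2)[of n]
    by (simp add: rf_frob_nat_def)
qed

locale torsion_free_rf_object = rf_object u T A for u T and A :: "'a rf_system" +
  assumes T_stable: "divisor_stable T" and torsion_free: "no_torsion T (rf_ring A {1})"
begin

text \<open>The index \<open>{1}\<close> is kept from being rewritten to \<open>{Suc 0}\<close>, which facts about it would not
  match.\<close>

context
  notes One_nat_def [simp del]
begin

abbreviation R :: "'a ring" where "R \<equiv> rf_ring A {1}"

text \<open>The element \<open>\<pi> F\<^sub>n(a)\<close>, the \<open>n\<close>-th ghost component that the Witt vector of \<open>a\<close> must have.\<close>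

definition ghost_component :: "nat set \<Rightarrow> 'a \<Rightarrow> nat \<Rightarrow> 'a" where
  "ghost_component S a n = rf_res A (S \<oslash> n) {1} (rf_frob_nat A n S a)"

lemma is_ring_R: "is_ring u R"
  using T_stable by (intro ring singleton_ds_subset)

lemma witt_vectors: "S \<preceq> T \<Longrightarrow> torsion_free_witt_vectors R S"
  using is_ring_R torsion_free by (rule torsion_free_witt_vectorsI)

lemma quot_1_subset:
  assumes "S \<preceq> T" "n \<in> S"
  shows "{1} \<preceq> S \<oslash> n"
  using assms by (meson divisor_stable_quot ds_subset_stable singleton_ds_subset)

lemma ghost_component_hom:
  assumes "S \<preceq> T" "n \<in> S"
  shows "(\<lambda>a. ghost_component S a n) \<in> homs u (rf_ring A S) R"
  unfolding ghost_component_def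
  using frob_nat_hom[OF assms] res_hom[OF quot_1_subset[OF assms] ds_quot_subset[OF assms]]
  by (rule homs_comp)

lemma ghost_component_1:
  "ghost_component S a 1 = rf_res A S {1} a"
  by (simp add: ghost_component_def rf_frob_nat_def)

lemma ghost_component_prime_times:
  assumes "S \<preceq> T" "prime p" "p * n \<in> S" "a \<in> carrier (rf_ring A S)"
  shows "ghost_component S a (p * n) = ghost_component (S \<oslash> p) (rf_frob A p S a) n"
  using assms ds_subset_stable[OF assms(1)]
  by (simp add: ghost_component_def frob_nat_prime_times(1) ds_quot_quot)

lemma ghost_component_res:
  assumes "S1 \<preceq> S2" "S2 \<preceq> T" "n \<in> S1" "a \<in> carrier (rf_ring A S2)"
  shows "ghost_component S1 (rf_res A S2 S1 a) n = ghost_component S2 a n"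
proof -
  have "n \<in> S2"
    using assms by (auto simp: ds_subset_def)
  then show ?thesis
    using assms ds_subset_trans[OF assms(1,2)]
    by (simp add: ghost_component_def res_res ds_quot_mono ds_quot_subset quot_1_subset frob_nat_closed
        flip: res_frob_nat)
qed

text \<open>Apply \<open>dwork\<close> to the family \<open>F\<^sub>n(a)\<close>, for which the required congruences are the equalities
  \<open>F\<^sub>p F\<^sub>n = F\<^bsub>p n\<^esub>\<close>, and map the coordinates to the ring at \<open>{1}\<close>.\<close>

lemma ghost_component_lift_ex:
  assumes S: "S \<preceq> T" and a: "a \<in> carrier (rf_ring A S)"
  shows "\<exists>x\<in>carrier (witt_ring R S). \<forall>n\<in>S. ghost R S x n = ghost_component S a n"
proof -
  have stable: "divisor_stable S"
    using S by (rule ds_subset_stable)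
  have "\<exists>x. \<forall>n\<in>S. x n \<in> carrier (rf_ring A (S \<oslash> n)) \<and>
    rf_frob_nat A n S a = (\<Oplus>\<^bsub>rf_ring A (S \<oslash> n)\<^esub>d\<in>{d. d dvd n}. add_pow (rf_ring A (S \<oslash> n)) d
      (rng_pow (rf_ring A (S \<oslash> n)) (rf_res A (S \<oslash> d) (S \<oslash> n) (x d)) (n div d)))"
  proof (rule dwork[OF S])
    fix p n :: nat assume pn: "prime p" "p * n \<in> S"
    interpret M: comm_rng "rf_ring A (S \<oslash> (p * n))"
      using S pn by (intro rng ds_quot_subset)
    have "rf_frob_nat A (p * n) S a \<in> carrier (rf_ring A (S \<oslash> (p * n)))"
      using S pn a by (intro frob_nat_closed)
    then show "\<exists>b\<in>carrier (rf_ring A (S \<oslash> (p * n))). rf_frob_nat A (p * n) S a =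
        rf_frob A p (S \<oslash> n) (rf_frob_nat A n S a) \<oplus>\<^bsub>rf_ring A (S \<oslash> (p * n))\<^esub>
          add_pow (rf_ring A (S \<oslash> (p * n))) (p ^ multiplicity p (p * n)) b"
      using frob_nat_prime_times(2)[OF S pn a]
      by (intro bexI[of _ "\<zero>\<^bsub>rf_ring A (S \<oslash> (p * n))\<^esub>"]) auto
  qed (use S a frob_nat_closed in blast)
  then obtain x where x: "\<And>n. n \<in> S \<Longrightarrow> x n \<in> carrier (rf_ring A (S \<oslash> n))"
    "\<And>n. n \<in> S \<Longrightarrow> rf_frob_nat A n S a = (\<Oplus>\<^bsub>rf_ring A (S \<oslash> n)\<^esub>d\<in>{d. d dvd n}.
      add_pow (rf_ring A (S \<oslash> n)) d
      (rng_pow (rf_ring A (S \<oslash> n)) (rf_res A (S \<oslash> d) (S \<oslash> n) (x d)) (n div d)))"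
    by blast
  let ?y = "\<lambda>n\<in>S. rf_res A (S \<oslash> n) {1} (x n)"
  have y: "rf_res A (S \<oslash> n) {1} (x n) \<in> carrier R" if "n \<in> S" for n
    using x(1) that S by (intro res_closed quot_1_subset ds_quot_subset)
  have "ghost R S ?y n = ghost_component S a n" if n: "n \<in> S" for n
  proof -
    interpret res: comm_rng_hom "rf_ring A (S \<oslash> n)" R "rf_res A (S \<oslash> n) {1}"
      using n S
      by (intro comm_rng_hom.intro comm_rng_hom_axioms.intro rng res_rng_hom quot_1_subset ds_quot_subset singleton_ds_subset T_stable)
    have d: "d \<in> S" "n div d > 0"
        "rf_res A (S \<oslash> d) (S \<oslash> n) (x d) \<in> carrier (rf_ring A (S \<oslash> n))"
        "rf_res A (S \<oslash> n) {1} (rf_res A (S \<oslash> d) (S \<oslash> n) (x d)) = rf_res A (S \<oslash> d) {1} (x d)"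
      if "d dvd n" for d
    proof -
      show "d \<in> S"
        using divisor_stable_dvd[OF stable n that] .
      then show "rf_res A (S \<oslash> d) (S \<oslash> n) (x d) \<in> carrier (rf_ring A (S \<oslash> n))"
          "rf_res A (S \<oslash> n) {1} (rf_res A (S \<oslash> d) (S \<oslash> n) (x d)) = rf_res A (S \<oslash> d) {1} (x d)"
        using that n S x(1)
        by (intro res_closed res_res ds_quot_antimono stable ds_quot_subset quot_1_subset; simp)+
      show "n div d > 0"
        using div_divisor_pos[OF divisor_stable_pos[OF stable n] that] .
    qed
    have "ghost_component S a n = (\<Oplus>\<^bsub>R\<^esub>d\<in>{d. d dvd n}. rf_res A (S \<oslash> n) {1}
        (add_pow (rf_ring A (S \<oslash> n)) d
          (rng_pow (rf_ring A (S \<oslash> n)) (rf_res A (S \<oslash> d) (S \<oslash> n) (x d)) (n div d))))"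
      unfolding ghost_component_def x(2)[OF n]
      using d by (intro res.finsum res.dom.add.nat_pow_closed res.dom.rng_pow_closed) auto
    also have "\<dots> = (\<Oplus>\<^bsub>R\<^esub>d\<in>{d. d dvd n}. add_pow R d (rng_pow R (?y d) (n div d)))"
      using d y by (intro res.cod.finsum_cong' Pi_I res.cod.add.nat_pow_closed res.cod.rng_pow_closed)
        (auto simp: res.add_pow res.rng_pow res.dom.rng_pow_closed)
    finally show ?thesis
      using n by (simp add: ghost_def)
  qed
  moreover have "?y \<in> carrier (witt_ring R S)"
    using y by (simp add: carrier_witt_ring[of R S])
  ultimately show ?thesis
    by blast
qed

definition lift :: "nat set \<Rightarrow> 'a \<Rightarrow> nat \<Rightarrow> 'a" where
  "lift S a = (SOME x. x \<in> carrier (witt_ring R S) \<and> (\<forall>n\<in>S. ghost R S x n = ghost_component S a n))"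

lemma
  assumes "S \<preceq> T" "a \<in> carrier (rf_ring A S)"
  shows lift_closed: "lift S a \<in> carrier (witt_ring R S)"
    and ghost_lift: "n \<in> S \<Longrightarrow> ghost R S (lift S a) n = ghost_component S a n"
proof -
  have "\<exists>x. x \<in> carrier (witt_ring R S) \<and> (\<forall>n\<in>S. ghost R S x n = ghost_component S a n)"
    using ghost_component_lift_ex[OF assms] by blast
  from someI_ex[OF this] show "lift S a \<in> carrier (witt_ring R S)"
    and "n \<in> S \<Longrightarrow> ghost R S (lift S a) n = ghost_component S a n"
    by (simp_all add: lift_def)
qed

text \<open>Both sides of every equation required of a morphism have the same ghost components, by the
  corresponding properties of \<open>a \<mapsto> \<pi> F\<^sub>n(a)\<close>, and are therefore equal.\<close>

lemma witt_lift_lift: "witt_lift u T A lift"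
  unfolding witt_lift_def
proof (intro conjI ballI)
  have object: "rf_object u T (witt_system R)"
    using is_ring_R torsion_free by (rule rf_object_witt_system)
  show "rf_morphism u T A (witt_system R) lift"
  proof (intro rf_morphism.intro rf_object_axioms object rf_morphism_axioms.intro)
    fix S assume S: "S \<preceq> T"
    interpret W: torsion_free_witt_vectors R S
      using S by (rule witt_vectors)
    interpret A: comm_rng "rf_ring A S"
      using S by (rule rng)
    have comp: "(\<lambda>a. ghost_component S a n) \<in> rng_hom (rf_ring A S) R"
      "u \<Longrightarrow> ghost_component S \<one>\<^bsub>rf_ring A S\<^esub> n = \<one>\<^bsub>R\<^esub>" if "n \<in> S" for n
      using ghost_component_hom[OF S that] by (auto simp: homs_iff)
    show "lift S \<in> homs u (rf_ring A S) (rf_ring (witt_system R) S)"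
      unfolding homs_iff
    proof (intro conjI impI)
      show "lift S \<in> rng_hom (rf_ring A S) (rf_ring (witt_system R) S)"
        by (auto simp: rng_hom_def lift_closed[OF S] ghost_lift[OF S] W.ghost_add W.ghost_mult
            W.witt_add_closed W.witt_mult_closed A.m_closed rng_homD[OF comp(1)] intro!: W.witt_eqI)
      assume u
      then have R1: "is_ring True R" and A1: "\<one>\<^bsub>rf_ring A S\<^esub> \<in> carrier (rf_ring A S)"
        using is_ring_R ring[OF S] by (auto simp: is_ring_iff)
      show "lift S \<one>\<^bsub>rf_ring A S\<^esub> = \<one>\<^bsub>rf_ring (witt_system R) S\<^esub>"
        using \<open>u\<close> by (auto simp: lift_closed[OF S A1] ghost_lift[OF S A1] comp(2)
            witt_one_closed[OF R1] W.ghost_one[OF R1] intro!: W.witt_eqI)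
    qed
    fix p a assume p: "prime p" "p \<in> S" and a: "a \<in> carrier (rf_ring A S)"
    have Sp: "S \<oslash> p \<preceq> T"
      using S p(2) by (rule ds_quot_subset)
    interpret Wp: torsion_free_witt_vectors R "S \<oslash> p"
      using Sp by (rule witt_vectors)
    have Fa: "rf_frob A p S a \<in> carrier (rf_ring A (S \<oslash> p))"
      using S p a by (rule frob_closed)
    have "lift (S \<oslash> p) (rf_frob A p S a) = witt_frob R p S (lift S a)"
    proof (rule Wp.witt_eqI)
      show "lift (S \<oslash> p) (rf_frob A p S a) \<in> carrier (witt_ring R (S \<oslash> p))"
        using Sp Fa by (rule lift_closed)
      show "witt_frob R p S (lift S a) \<in> carrier (witt_ring R (S \<oslash> p))"
        using lift_closed[OF S a] by (rule W.witt_frob_closed)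
      fix n assume n: "n \<in> S \<oslash> p"
      then have "p * n \<in> S"
        by (simp add: ds_quot_def mult.commute)
      then show "ghost R (S \<oslash> p) (lift (S \<oslash> p) (rf_frob A p S a)) n =
          ghost R (S \<oslash> p) (witt_frob R p S (lift S a)) n"
        using n by (simp add: ghost_lift[OF Sp Fa] W.ghost_frob[OF lift_closed[OF S a] p(2)]
            ghost_lift[OF S a] ghost_component_prime_times[OF S p(1) _ a])
    qed
    then show "lift (S \<oslash> p) (rf_frob A p S a) = rf_frob (witt_system R) p S (lift S a)"
      by simp
  next
    fix S1 S2 a assume S: "S1 \<preceq> S2" "S2 \<preceq> T" and a: "a \<in> carrier (rf_ring A S2)"
    have S1: "S1 \<preceq> T"
      using S by (rule ds_subset_trans)
    interpret W1: torsion_free_witt_vectors R S1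
      using S1 by (rule witt_vectors)
    interpret W2: torsion_free_witt_vectors R S2
      using S(2) by (rule witt_vectors)
    have ra: "rf_res A S2 S1 a \<in> carrier (rf_ring A S1)"
      using S a by (rule res_closed)
    have "lift S1 (rf_res A S2 S1 a) = restrict (lift S2 a) S1"
    proof (rule W1.witt_eqI)
      show "lift S1 (rf_res A S2 S1 a) \<in> carrier (witt_ring R S1)"
        using S1 ra by (rule lift_closed)
      show "restrict (lift S2 a) S1 \<in> carrier (witt_ring R S1)"
        using lift_closed[OF S(2) a] S(1) by (auto simp: ds_subset_def intro: restrict_witt_closed)
      fix n assume n: "n \<in> S1"
      then have "n \<in> S2"
        using S(1) by (auto simp: ds_subset_def)
      then show "ghost R S1 (lift S1 (rf_res A S2 S1 a)) n = ghost R S1 (restrict (lift S2 a) S1) n"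
        using n by (simp add: ghost_lift[OF S1 ra] W2.ghost_restrict[OF lift_closed[OF S(2) a] S(1)]
            ghost_lift[OF S(2) a] ghost_component_res[OF S _ a])
    qed
    then show "lift S1 (rf_res A S2 S1 a) = rf_res (witt_system R) S2 S1 (lift S2 a)"
      by simp
  qed
  fix a assume a: "a \<in> carrier R"
  have T1: "{1} \<preceq> T"
    using T_stable by (rule singleton_ds_subset)
  interpret W1: torsion_free_witt_vectors R "{1}"
    using T1 by (rule witt_vectors)
  have "lift {1} a 1 = a"
    using ghost_lift[OF T1 a, of 1] W1.ghost_at_1[OF lift_closed[OF T1 a]] a
    by (simp add: ghost_component_1 res_id[OF T1 a])
  then show "lift {1} a = (\<lambda>n\<in>{1}. a)"
    using lift_closed[OF T1 a] by (auto simp: carrier_witt_ring PiE_iff extensional_def fun_eq_iff)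
qed

text \<open>The ghost component at \<open>p * n\<close> of a Witt vector is that of its image under \<open>F\<^sub>p\<close> at \<open>n\<close>. A morphism
  commutes with \<open>F\<^sub>p\<close>, so by induction everything is reduced to the component at \<open>1\<close>, which factors
  through the ring at \<open>{1}\<close>, where \<open>\<beta>\<close> is the identity.\<close>

lemma ghost_witt_lift:
  assumes "witt_lift u T A \<beta>" "S \<preceq> T" "a \<in> carrier (rf_ring A S)" "n \<in> S"
  shows "ghost R S (\<beta> S a) n = ghost_component S a n"
proof -
  interpret rf_morphism u T A "witt_system R" \<beta>
    using assms(1) by (simp add: witt_lift_def)
  have \<beta>1: "\<beta> {1} a = (\<lambda>n\<in>{1}. a)" if "a \<in> carrier R" for a
    using assms(1) that by (simp add: witt_lift_def)
  have closed: "\<beta> S a \<in> carrier (witt_ring R S)" if "S \<preceq> T" "a \<in> carrier (rf_ring A S)" for S a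
    using hom[OF that(1)] that(2) by (auto simp: homs_iff intro: rng_homD(1))
  show ?thesis
    using assms(2-)
  proof (induction n arbitrary: S a rule: prime_divisors_induct)
    case zero
    then show ?case
      using ds_subset_stable divisor_stable_pos by blast
  next
    case (unit n)
    interpret W: torsion_free_witt_vectors R S
      using unit.prems(1) by (rule witt_vectors)
    have S1: "{1} \<preceq> S"
      using unit.prems by (meson ds_subset_stable singleton_ds_subset)
    have "ghost R S (\<beta> S a) 1 = restrict (\<beta> S a) {1} 1"
      using W.ghost_at_1[OF closed[OF unit.prems(1,2)]] by simp
    also have "restrict (\<beta> S a) {1} = \<beta> {1} (rf_res A S {1} a)"
      using res[OF S1 unit.prems(1,2)] by simp
    finally show ?case
      using unit res_closed[OF S1 unit.prems(1,2)] by (simp add: \<beta>1 ghost_component_1)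
  next
    case (factor p n)
    interpret W: torsion_free_witt_vectors R S
      using factor.prems(1) by (rule witt_vectors)
    have p: "prime p" "p \<in> S" "n \<in> S \<oslash> p"
      using factor W.dvd[OF factor.prems(3)] by (auto simp: mem_ds_quot W.stable mult.commute)
    have "ghost R S (\<beta> S a) (p * n) = ghost R (S \<oslash> p) (witt_frob R p S (\<beta> S a)) n"
      using W.ghost_frob[OF closed[OF factor.prems(1,2)] p(2,3)] by simp
    also have "witt_frob R p S (\<beta> S a) = \<beta> (S \<oslash> p) (rf_frob A p S a)"
      using frob[OF factor.prems(1) p(1,2) factor.prems(2)] by simp
    also have "ghost R (S \<oslash> p) \<dots> n = ghost_component (S \<oslash> p) (rf_frob A p S a) n"
      using factor.prems p by (intro factor.IH ds_quot_subset frob_closed)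
    also have "\<dots> = ghost_component S a (p * n)"
      using ghost_component_prime_times[OF factor.prems(1) p(1) factor.prems(3,2)] by simp
    finally show ?case .
  qed
qed

lemma witt_lift_closed:
  assumes "witt_lift u T A \<beta>" "S \<preceq> T" "a \<in> carrier (rf_ring A S)"
  shows "\<beta> S a \<in> carrier (witt_ring R S)"
proof -
  interpret rf_morphism u T A "witt_system R" \<beta>
    using assms(1) by (simp add: witt_lift_def)
  show ?thesis
    using hom[OF assms(2)] assms(3) by (auto simp: homs_iff intro: rng_homD(1))
qed

lemma witt_lift_unique:
  assumes "witt_lift u T A \<beta>" "S \<preceq> T" "a \<in> carrier (rf_ring A S)"
  shows "\<beta> S a = lift S a"
proof -
  interpret W: torsion_free_witt_vectors R S
    using assms(2) by (rule witt_vectors)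
  show ?thesis
    using assms by (intro W.witt_eqI) (simp_all add: witt_lift_closed lift_closed ghost_witt_lift ghost_lift)
qed

end

end

text \<open>The \<open>n\<close>-th ghost components of both sides are \<open>f {1} (\<pi> F\<^sub>n(a))\<close>, for the left one because \<open>f\<close>
  commutes with \<open>\<pi>\<close> and \<open>F\<^sub>n\<close>.\<close>

lemma witt_lift_functorial:
  assumes A: "torsion_free_rf_object u T A" and B: "torsion_free_rf_object u T B"
    and f: "rf_morphism u T A B f" and \<alpha>: "witt_lift u T A \<alpha>" and \<beta>: "witt_lift u T B \<beta>"
    and S: "S \<preceq> T" and a: "a \<in> carrier (rf_ring A S)"
  shows "\<beta> S (f S a) = witt_map (f {1}) S (\<alpha> S a)"
proof -
  interpret A: torsion_free_rf_object u T A by fact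
  interpret B: torsion_free_rf_object u T B by fact
  interpret f: rf_morphism u T A B f by fact
  interpret W: torsion_free_witt_vectors B.R S
    using S by (rule B.witt_vectors)
  have T1: "{1} \<preceq> T"
    using A.T_stable by (rule singleton_ds_subset)
  have f1: "f {1} \<in> rng_hom A.R B.R"
    using f.hom[OF T1] by (simp add: homs_iff)
  have fa: "f S a \<in> carrier (rf_ring B S)"
    using f.hom[OF S] a by (auto simp: homs_iff intro: rng_homD(1))
  show ?thesis
  proof (rule W.witt_eqI)
    show "\<beta> S (f S a) \<in> carrier W.W"
      using \<beta> S fa by (rule B.witt_lift_closed)
    show "witt_map (f {1}) S (\<alpha> S a) \<in> carrier W.W"
      using f1 A.witt_lift_closed[OF \<alpha> S a] by (rule witt_map_closed)
    fix n assume n: "n \<in> S"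
    have "ghost B.R S (\<beta> S (f S a)) n = B.ghost_component S (f S a) n"
      using \<beta> S fa n by (rule B.ghost_witt_lift)
    also have "\<dots> = f {1} (A.ghost_component S a n)"
      using f.frob_nat[OF S n a] f.res[OF A.quot_1_subset[OF S n] ds_quot_subset[OF S n] A.frob_nat_closed[OF S n a]]
      by (simp add: A.ghost_component_def B.ghost_component_def)
    also have "A.ghost_component S a n = ghost A.R S (\<alpha> S a) n"
      using A.ghost_witt_lift[OF \<alpha> S a n] by simp
    also have "f {1} \<dots> = ghost B.R S (witt_map (f {1}) S (\<alpha> S a)) n"
      using ghost_witt_map[OF A.rng[OF T1] B.rng[OF T1] f1 W.stable A.witt_lift_closed[OF \<alpha> S a] n] by simp
    finally show "ghost B.R S (\<beta> S (f S a)) n = ghost B.R S (witt_map (f {1}) S (\<alpha> S a)) n" .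
  qed
qed

theorem proposition1:
  fixes u :: bool and T :: "nat set" and A :: "'a rf_system"
  assumes "divisor_stable T"
    and "rf_object u T A"
    and "no_torsion T (rf_ring A {1})"
  shows "\<exists>\<alpha>. witt_lift u T A \<alpha> \<and>
     (\<forall>\<beta>. witt_lift u T A \<beta> \<longrightarrow>
        (\<forall>S a. S \<preceq> T \<and> a \<in> carrier (rf_ring A S) \<longrightarrow> \<beta> S a = \<alpha> S a)) \<and>
     (\<forall>(B :: 'b rf_system) f \<beta>.
        rf_object u T B \<and> no_torsion T (rf_ring B {1}) \<and>
        rf_morphism u T A B f \<and> witt_lift u T B \<beta> \<longrightarrow>
        (\<forall>S a. S \<preceq> T \<and> a \<in> carrier (rf_ring A S) \<longrightarrow>
           \<beta> S (f S a) = witt_map (f {1}) S (\<alpha> S a))) \<and>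
     (\<forall>S. S \<preceq> T \<longrightarrow>
        inj_on (ghost (rf_ring A {1}) S) (carrier (witt_ring (rf_ring A {1}) S))) \<and>
     (\<forall>S a. S \<preceq> T \<and> a \<in> carrier (rf_ring A S) \<longrightarrow>
        ghost (rf_ring A {1}) S (\<alpha> S a) =
          (\<lambda>n\<in>S. rf_res A (S \<oslash> n) {1} (rf_frob_nat A n S a)))"
proof -
  interpret torsion_free_rf_object u T A
    using assms by (intro torsion_free_rf_object.intro torsion_free_rf_object_axioms.intro)
  show ?thesis
  proof (intro exI[of _ lift] conjI allI impI; (elim conjE)?)
    show "witt_lift u T A lift"
      by (rule witt_lift_lift)
    show "\<beta> S a = lift S a" if "witt_lift u T A \<beta>" "S \<preceq> T" "a \<in> carrier (rf_ring A S)" for \<beta> S a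
      using that by (rule witt_lift_unique)
    show "\<beta> S (f S a) = witt_map (f {1}) S (lift S a)"
      if "rf_object u T B" "no_torsion T (rf_ring B {1})" "rf_morphism u T A B f" "witt_lift u T B \<beta>"
        "S \<preceq> T" "a \<in> carrier (rf_ring A S)" for B :: "'b rf_system" and f \<beta> S a
    proof (rule witt_lift_functorial)
      show "torsion_free_rf_object u T B"
        using that(1,2) assms(1) by (intro torsion_free_rf_object.intro torsion_free_rf_object_axioms.intro)
    qed (use that witt_lift_lift torsion_free_rf_object_axioms in auto)
    show "inj_on (ghost R S) (carrier (witt_ring R S))" if "S \<preceq> T" for S
      using torsion_free_witt_vectors.ghost_inj[OF witt_vectors[OF that]] .
    show "ghost R S (lift S a) = (\<lambda>n\<in>S. rf_res A (S \<oslash> n) {1} (rf_frob_nat A n S a))"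
      if "S \<preceq> T" "a \<in> carrier (rf_ring A S)" for S a
      using ghost_lift[OF that] by (auto simp: fun_eq_iff ghost_component_def) (simp add: ghost_def)
  qed
qed

end
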